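(* Let $n \ge 1$, let $d \ge 2$ be even, and let $F \in \mathbb{R}(n,d)$ be a real homogeneous polynomial of degree $d$ in $n$ variables. If $F \ge 0$, then the characteristic polynomial of $F$ satisfies $\chi(F)(t) \ge 0$ for all $t \in \mathbb{R}_{\ge 0}$.
   Context: For a field $K$, $K(n,d)$ denotes the $K$-vector space of homogeneous polynomials of degree $d$ in $n$ variables $x_1,\dots,x_n$ with coefficients in $K$ (including $0$). For $F \in \mathbb{R}(n,d)$, $F \ge 0$ (non-negative) means $F(x)\ge 0$ for all $x\in\mathbb{R}^n$. Let $\nabla(n,d,\mathbb{C}) = \{F \in \mathbb{C}(n,d) : \text{there is } x\in\mathbb{C}^n\setminus\{0\} \text{ with } \frac{\partial F}{\partial x_i}(x)=0 \text{ for all } i\}$ be the set of singular polynomials. It is known to be an irreducible algebraic hypersurface in $\mathbb{C}(n,d)$ of degree $D=n(d-1)^{n-1}$, defined over $\mathbb{Q}$. The discriminant $\Delta$ is the irreducible polynomial in the coefficients of $F$, homogeneous of degree $D$, with rational coefficients, such that $\nabla(n,d,\mathbb{C})=\{F\in\mathbb{C}(n,d) : \Delta(F)=0\}$, normalized by $\Delta(J)=1$, where $J(x)=\sum_{j=1}^n x_j^d$. The characteristic polynomial of $F$ is $\chi(F)(t)=\Delta(F+tJ)\in\mathbb{R}[t]$. *)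

theory Defs
  imports
    "HOL-Computational_Algebra.Computational_Algebra"
    "HOL-Library.Poly_Mapping"
begin

text \<open>
  Polynomials in commuting variables indexed by \<^typ>\<open>'v\<close> are finitely supported
  functions from monomials to coefficients; the multiplication of \<^theory>\<open>HOL-Library.Poly_Mapping\<close>
  is the usual one.
\<close>

type_synonym 'v monom = "'v \<Rightarrow>\<^sub>0 nat"
type_synonym ('v, 'a) mpoly = "'v monom \<Rightarrow>\<^sub>0 'a"

definition vars :: "('v, 'a::zero) mpoly \<Rightarrow> 'v set" where
  "vars p = (\<Union>m\<in>Poly_Mapping.keys p. Poly_Mapping.keys m)"

definition monom_degree :: "'v monom \<Rightarrow> nat" where
  "monom_degree m = (\<Sum>i\<in>Poly_Mapping.keys m. Poly_Mapping.lookup m i)"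

definition homogeneous :: "nat \<Rightarrow> ('v, 'a::zero) mpoly \<Rightarrow> bool" where
  "homogeneous d p \<longleftrightarrow> (\<forall>m\<in>Poly_Mapping.keys p. monom_degree m = d)"

text \<open>Evaluation at \<open>x\<close>, with the coefficients sent to the target ring by \<open>h\<close>.\<close>

definition eval_mpoly ::
    "('a::zero \<Rightarrow> 'b::comm_semiring_1) \<Rightarrow> ('v \<Rightarrow> 'b) \<Rightarrow> ('v, 'a) mpoly \<Rightarrow> 'b" where
  "eval_mpoly h x p = (\<Sum>m\<in>Poly_Mapping.keys p. h (Poly_Mapping.lookup p m) * (\<Prod>i\<in>Poly_Mapping.keys m. x i ^ Poly_Mapping.lookup m i))"

text \<open>
  The truncated exponent \<open>m - e\<^sub>i\<close> is harmless where \<open>i\<close> does not occur in \<open>m\<close>, since the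
  coefficient is then \<open>0\<close>.
\<close>

definition partial_deriv :: "'v \<Rightarrow> ('v, 'a::comm_semiring_1) mpoly \<Rightarrow> ('v, 'a) mpoly" where
  "partial_deriv i p =
     (\<Sum>m\<in>Poly_Mapping.keys p. Poly_Mapping.single (m - Poly_Mapping.single i 1)
                    (of_nat (Poly_Mapping.lookup m i) * Poly_Mapping.lookup p m))"

text \<open>
  The space \<open>K(n,d)\<close>. The variables are \<open>x\<^sub>0, \<dots>, x\<^bsub>n-1\<^esub>\<close>; a point of \<open>K\<^sup>n\<close> is given by
  a function on \<^typ>\<open>nat\<close> of which only the values below \<open>n\<close> matter.
\<close>

definition forms :: "nat \<Rightarrow> nat \<Rightarrow> (nat, 'a::zero) mpoly set" where
  "forms n d = {F. vars F \<subseteq> {..<n} \<and> homogeneous d F}"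

abbreviation eval_form :: "(nat, 'a::comm_semiring_1) mpoly \<Rightarrow> (nat \<Rightarrow> 'a) \<Rightarrow> 'a" where
  "eval_form F x \<equiv> eval_mpoly (\<lambda>c. c) x F"

definition nonneg_form :: "(nat, real) mpoly \<Rightarrow> bool" where
  "nonneg_form F \<longleftrightarrow> (\<forall>x. eval_form F x \<ge> 0)"

definition singular_forms :: "nat \<Rightarrow> nat \<Rightarrow> (nat, complex) mpoly set" where
  "singular_forms n d =
     {F \<in> forms n d. \<exists>x. (\<exists>i<n. x i \<noteq> 0) \<and> (\<forall>i<n. eval_form (partial_deriv i F) x = 0)}"

definition fermat_form :: "nat \<Rightarrow> nat \<Rightarrow> (nat, 'a::comm_semiring_1) mpoly" where
  "fermat_form n d = (\<Sum>j<n. Poly_Mapping.single (Poly_Mapping.single j d) 1)"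

definition const_mpoly :: "'a::zero \<Rightarrow> ('v, 'a) mpoly" where
  "const_mpoly c = Poly_Mapping.single 0 c"

text \<open>
  A polynomial in the coefficients of a form has one variable for each monomial
  \<open>x\<^sup>m\<close>, and its value at \<open>F\<close> is obtained by substituting \<open>Poly_Mapping.lookup F m\<close> for that variable.
  The coefficients of the discriminant are rational by its type; irreducibility is over
  the complex numbers, as \<open>\<nabla>(n,d,\<complex>)\<close> is an irreducible complex hypersurface.
  (Variables that do not occur in a polynomial over a field do not occur in its factors
  either, so it is immaterial that the ambient polynomial ring has further variables.)
\<close>

definition is_discriminant :: "nat \<Rightarrow> nat \<Rightarrow> (nat monom, rat) mpoly \<Rightarrow> bool" where
  "is_discriminant n d \<Delta> \<longleftrightarrow>
     vars \<Delta> \<subseteq> {m. Poly_Mapping.keys m \<subseteq> {..<n} \<and> monom_degree m = d} \<and>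
     irreducible (Poly_Mapping.map of_rat \<Delta> :: (nat monom, complex) mpoly) \<and>
     homogeneous (n * (d - 1) ^ (n - 1)) \<Delta> \<and>
     singular_forms n d = {F \<in> forms n d. eval_mpoly of_rat (Poly_Mapping.lookup F) \<Delta> = 0} \<and>
     eval_mpoly (\<lambda>c. c) (Poly_Mapping.lookup (fermat_form n d)) \<Delta> = 1"

text \<open>\<open>\<chi>(F) = \<Delta>(F + tJ)\<close>, where \<open>F + tJ\<close> is a form with coefficients in \<open>\<real>[t]\<close>.\<close>

definition char_poly_form ::
    "nat \<Rightarrow> nat \<Rightarrow> (nat monom, rat) mpoly \<Rightarrow> (nat, real) mpoly \<Rightarrow> real poly" where
  "char_poly_form n d \<Delta> F =
     eval_mpoly (\<lambda>c. [:of_rat c:])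
       (Poly_Mapping.lookup (Poly_Mapping.map (\<lambda>c. [:c:]) F + const_mpoly [:0, 1:] * fermat_form n d)) \<Delta>"

lemma lookup_const_mult:
  fixes p :: "('v, 'a::comm_semiring_1) mpoly"
  shows "Poly_Mapping.lookup (const_mpoly c * p) m = c * Poly_Mapping.lookup p m"
  unfolding const_mpoly_def
  by (simp add: mult_map_scale_conv_mult [symmetric] Poly_Mapping.map.rep_eq when_def)

lemma poly_char_poly_form:
  "poly (char_poly_form n d \<Delta> F) t =
     eval_mpoly of_rat (Poly_Mapping.lookup (F + const_mpoly t * fermat_form n d)) \<Delta>"
proof -
  have J: "poly (Poly_Mapping.lookup (fermat_form n d) m) t = Poly_Mapping.lookup (fermat_form n d) m" for m
    by (auto simp: fermat_form_def lookup_sum poly_sum lookup_single when_def intro!: sum.cong)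
  have "poly (Poly_Mapping.lookup (Poly_Mapping.map (\<lambda>c. [:c:]) F + const_mpoly [:0, 1:] * fermat_form n d) m) t
        = Poly_Mapping.lookup (F + const_mpoly t * fermat_form n d) m" for m
    by (simp add: lookup_add lookup_const_mult J Poly_Mapping.map.rep_eq when_def)
  then show ?thesis
    by (simp add: char_poly_form_def eval_mpoly_def poly_sum poly_prod)
qed

end

theory Submission
  imports Defs "HOL-Library.FuncSet"
begin

text \<open>
  Write \<open>J = \<Sum>\<^sub>j x\<^sub>j\<^sup>d\<close> and call a real form \<open>G\<close> positive definite if it is positive away from the origin.
  For \<open>F \<ge> 0\<close> and \<open>t > 0\<close> the form \<open>F + tJ\<close> is positive definite, and \<open>t = 0\<close> is a limit of such
  \<open>t\<close>; so it suffices to show \<open>\<Delta>(G) \<ge> 0\<close> for positive definite \<open>G\<close>.  The positive definite forms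
  are a convex cone containing \<open>J\<close>, where \<open>\<Delta> = 1\<close>.  The discriminant does vanish inside this cone
  (at \<open>(x\<^sup>2 + y\<^sup>2)\<^sup>2\<close>, for instance), but only on a set of codimension two, which cannot separate the
  cone: by Euler's identity a positive definite form has no real singular point, so a singular point
  \<open>z\<close> is not a multiple of a real one, the form is also singular at the conjugate of \<open>z\<close>, and
  being singular at two given independent points is \<open>2n\<close> linear conditions, while the pair depends
  on \<open>2(n - 1)\<close> real parameters only.

  The codimension count is made algebraic.  Fix \<open>W = G - J\<close> and let \<open>N\<close> be the number of
  monomials of degree \<open>d\<close>.  If some \<open>Y + sW\<close> is singular at two independent points, then \<open>2n\<close>
  coefficients of \<open>Y\<close> are rational functions of the other \<open>N - 2n\<close>, of \<open>s\<close> and of the \<open>2(n - 1)\<close>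
  affine coordinates of the two points (\<open>coefficients_rational\<close>).  So all \<open>N\<close> coefficients of \<open>Y\<close> are
  rational functions of \<open>N - 1\<close> quantities, and comparing the numbers of monomials yields one non-zero
  polynomial that vanishes at every such \<open>Y\<close> (\<open>dimension_bound\<close>).  A real \<open>Y\<close> arbitrarily near \<open>J\<close> at
  which it does not vanish (\<open>generic_avoidance\<close>) gives a segment from \<open>Y\<close> to \<open>Y + W\<close> without such
  forms.  Near \<open>J\<close> the segment remains in the positive definite cone, hence meets no singular form at
  all, and \<open>\<Delta>\<close> keeps its sign along it: \<open>\<Delta>(Y) > 0\<close> excludes \<open>\<Delta>(Y + W) < 0\<close>, and \<open>Y + W\<close> is near
  \<open>G\<close>.

  The \<open>2n\<close> conditions are independent only for \<open>d \<ge> 3\<close>.  In degree \<open>2\<close> the gradient is linear, and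
  then the real part of a suitably scaled singular point would be a real singular point, so that
  a positive definite quadratic form is not singular at all.
\<close>

section \<open>Rational functions of too few quantities\<close>

text \<open>Elimination of one unknown with the help of one equation that involves it.\<close>

lemma underdetermined_system:
  fixes M :: "'j \<Rightarrow> 'i \<Rightarrow> 'a::field"
  assumes "finite J" and "finite I" and "card J < card I"
  shows "\<exists>c. (\<exists>i\<in>I. c i \<noteq> 0) \<and> (\<forall>j\<in>J. (\<Sum>i\<in>I. M j i * c i) = 0)"
  using assms
proof (induction J arbitrary: I M rule: finite_induct)
  case empty
  then obtain i where "i \<in> I" by (metis card_gt_0_iff equals0I card.empty)
  then show ?case by (intro exI[of _ "\<lambda>_. 1"]) auto
next
  case (insert j J)
  show ?case
  proof (cases "\<forall>i\<in>I. M j i = 0")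
    case True
    have "card J < card I" using insert by simp
    then obtain c where c: "\<exists>i\<in>I. c i \<noteq> 0" "\<forall>j\<in>J. (\<Sum>i\<in>I. M j i * c i) = 0"
      using insert.IH[of I M] insert.prems by blast
    then show ?thesis using True by (intro exI[of _ c]) auto
  next
    case False
    then obtain i0 where i0: "i0 \<in> I" "M j i0 \<noteq> 0" by blast
    define I' where "I' = I - {i0}"
    define M' where "M' = (\<lambda>k i. M k i - M k i0 * M j i / M j i0)"
    have fin: "finite I'" "i0 \<notin> I'" and I: "I = insert i0 I'"
      using insert.prems i0 by (auto simp: I'_def)
    have "card J < card I'" using insert.prems insert.hyps fin by (simp add: I)
    then obtain c where c: "\<exists>i\<in>I'. c i \<noteq> 0" "\<forall>k\<in>J. (\<Sum>i\<in>I'. M' k i * c i) = 0"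
      using insert.IH[of I' M'] fin by blast
    define c0 where "c0 = - (\<Sum>i\<in>I'. M j i * c i) / M j i0"
    define c' where "c' = c(i0 := c0)"
    have split: "(\<Sum>i\<in>I. M k i * c' i) = M k i0 * c0 + (\<Sum>i\<in>I'. M k i * c i)" for k
    proof -
      have "(\<Sum>i\<in>I'. M k i * c' i) = (\<Sum>i\<in>I'. M k i * c i)"
        using fin by (intro sum.cong) (auto simp: c'_def)
      then show ?thesis using fin by (simp add: I c'_def)
    qed
    have "(\<Sum>i\<in>I. M k i * c' i) = 0" if "k \<in> insert j J" for k
    proof (cases "k = j")
      case True
      then show ?thesis using i0 unfolding split by (simp add: c0_def)
    next
      case False
      then have "0 = (\<Sum>i\<in>I'. M' k i * c i)" using c that by simp
      also have "\<dots> = (\<Sum>i\<in>I'. M k i * c i) - M k i0 / M j i0 * (\<Sum>i\<in>I'. M j i * c i)"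
        by (simp add: M'_def sum_distrib_left sum_subtractf [symmetric] algebra_simps)
      finally show ?thesis unfolding split by (simp add: c0_def)
    qed
    moreover have "\<exists>i\<in>I. c' i \<noteq> 0" using c(1) fin by (auto simp: I c'_def)
    ultimately show ?thesis by blast
  qed
qed

text \<open>
  The elements of \<open>V\<close> play the role of variables, but they are functions on a common domain, of which
  only the part \<open>G\<close> matters.  The bound \<open>e\<close> is on the exponent of each variable separately, so that
  the number of admissible monomials is \<open>(e + 1) ^ card V\<close>.
\<close>

definition polynomial_in :: "('x \<Rightarrow> 'a::comm_ring_1) set \<Rightarrow> 'x set \<Rightarrow> nat \<Rightarrow> ('x \<Rightarrow> 'a) \<Rightarrow> bool" where
  "polynomial_in V G e f \<longleftrightarrow>
     (\<exists>c. \<forall>t\<in>G. f t = (\<Sum>\<alpha>\<in>V \<rightarrow>\<^sub>E {..e}. c \<alpha> * (\<Prod>v\<in>V. v t ^ \<alpha> v)))"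

lemma polynomial_in_cong:
  assumes "\<And>t. t \<in> G \<Longrightarrow> f t = g t"
  shows "polynomial_in V G e f \<longleftrightarrow> polynomial_in V G e g"
  using assms by (simp add: polynomial_in_def)

lemma polynomial_in_mono:
  assumes "finite V" and "polynomial_in V G e f" and "e \<le> e'"
  shows "polynomial_in V G e' f"
proof -
  obtain c where c: "\<And>t. t \<in> G \<Longrightarrow> f t = (\<Sum>\<alpha>\<in>V \<rightarrow>\<^sub>E {..e}. c \<alpha> * (\<Prod>v\<in>V. v t ^ \<alpha> v))"
    using assms unfolding polynomial_in_def by blast
  define c' where "c' = (\<lambda>\<alpha>. if \<alpha> \<in> V \<rightarrow>\<^sub>E {..e} then c \<alpha> else 0)"
  have sub: "V \<rightarrow>\<^sub>E {..e} \<subseteq> V \<rightarrow>\<^sub>E {..e'}" using assms(3) by (intro PiE_mono) auto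
  have "f t = (\<Sum>\<alpha>\<in>V \<rightarrow>\<^sub>E {..e'}. c' \<alpha> * (\<Prod>v\<in>V. v t ^ \<alpha> v))" if "t \<in> G" for t
    unfolding c[OF that] using sub assms(1)
    by (intro sum.mono_neutral_cong_left) (auto simp: c'_def intro!: finite_PiE)
  then show ?thesis unfolding polynomial_in_def by blast
qed

lemma polynomial_in_const:
  assumes "finite V" shows "polynomial_in V G 0 (\<lambda>_. a)"
proof -
  have "V \<rightarrow>\<^sub>E {..0::nat} = {\<lambda>v\<in>V. 0}" by (auto simp: PiE_singleton[symmetric] restrict_def)
  then show ?thesis unfolding polynomial_in_def
    by (intro exI[of _ "\<lambda>_. a"]) simp
qed

lemma polynomial_in_var:
  assumes "finite V" and "f \<in> V" shows "polynomial_in V G 1 f"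
proof -
  define \<alpha>0 where "\<alpha>0 = (\<lambda>v\<in>V. if v = f then 1 else 0::nat)"
  have mem: "\<alpha>0 \<in> V \<rightarrow>\<^sub>E {..1}" by (auto simp: \<alpha>0_def)
  have "f t = (\<Sum>\<alpha>\<in>V \<rightarrow>\<^sub>E {..1}. of_bool (\<alpha> = \<alpha>0) * (\<Prod>v\<in>V. v t ^ \<alpha> v))" for t
  proof -
    have "(\<Sum>\<alpha>\<in>V \<rightarrow>\<^sub>E {..1}. of_bool (\<alpha> = \<alpha>0) * (\<Prod>v\<in>V. v t ^ \<alpha> v)) = (\<Prod>v\<in>V. v t ^ \<alpha>0 v)"
      using mem assms(1) by (simp add: of_bool_def if_distrib if_distribR sum.delta finite_PiE cong: if_cong)
    also have "\<dots> = (\<Prod>v\<in>V. if v = f then v t else 1)"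
      by (intro prod.cong) (auto simp: \<alpha>0_def)
    also have "\<dots> = f t" using assms by simp
    finally show ?thesis by simp
  qed
  then show ?thesis unfolding polynomial_in_def
    by (intro exI[of _ "\<lambda>\<alpha>. of_bool (\<alpha> = \<alpha>0)"]) blast
qed

lemma polynomial_in_add:
  assumes "polynomial_in V G e f" and "polynomial_in V G e g"
  shows "polynomial_in V G e (\<lambda>t. f t + g t)"
proof -
  obtain c c' where "\<forall>t\<in>G. f t = (\<Sum>\<alpha>\<in>V \<rightarrow>\<^sub>E {..e}. c \<alpha> * (\<Prod>v\<in>V. v t ^ \<alpha> v))"
    "\<forall>t\<in>G. g t = (\<Sum>\<alpha>\<in>V \<rightarrow>\<^sub>E {..e}. c' \<alpha> * (\<Prod>v\<in>V. v t ^ \<alpha> v))"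
    using assms unfolding polynomial_in_def by blast
  then show ?thesis unfolding polynomial_in_def
    by (intro exI[of _ "\<lambda>\<alpha>. c \<alpha> + c' \<alpha>"]) (simp add: sum.distrib distrib_right)
qed

lemma polynomial_in_mult:
  assumes V: "finite V" and f: "polynomial_in V G e f" and g: "polynomial_in V G e' g"
  shows "polynomial_in V G (e + e') (\<lambda>t. f t * g t)"
proof -
  obtain c c' where c: "\<And>t. t \<in> G \<Longrightarrow> f t = (\<Sum>\<alpha>\<in>V \<rightarrow>\<^sub>E {..e}. c \<alpha> * (\<Prod>v\<in>V. v t ^ \<alpha> v))"
    "\<And>t. t \<in> G \<Longrightarrow> g t = (\<Sum>\<alpha>\<in>V \<rightarrow>\<^sub>E {..e'}. c' \<alpha> * (\<Prod>v\<in>V. v t ^ \<alpha> v))"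
    using f g unfolding polynomial_in_def by blast
  define S where "S = (V \<rightarrow>\<^sub>E {..e}) \<times> (V \<rightarrow>\<^sub>E {..e'})"
  define add where "add = (\<lambda>(\<alpha>, \<beta>). \<lambda>v\<in>V. \<alpha> v + \<beta> v :: nat)"
  define q where "q = (\<lambda>\<gamma>. \<Sum>(\<alpha>, \<beta>)\<in>{p\<in>S. add p = \<gamma>}. c \<alpha> * c' \<beta>)"
  have finS: "finite S" using V by (auto simp: S_def intro!: finite_PiE)
  have img: "add ` S \<subseteq> V \<rightarrow>\<^sub>E {..e + e'}"
    by (fastforce simp: add_def S_def PiE_iff intro: add_mono)
  have "f t * g t = (\<Sum>\<gamma>\<in>V \<rightarrow>\<^sub>E {..e + e'}. q \<gamma> * (\<Prod>v\<in>V. v t ^ \<gamma> v))" if t: "t \<in> G" for t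
  proof -
    have "f t * g t = (\<Sum>(\<alpha>, \<beta>)\<in>S. (c \<alpha> * (\<Prod>v\<in>V. v t ^ \<alpha> v)) * (c' \<beta> * (\<Prod>v\<in>V. v t ^ \<beta> v)))"
      unfolding c(1)[OF t] c(2)[OF t] S_def by (simp add: sum_product sum.cartesian_product)
    also have "\<dots> = (\<Sum>p\<in>S. (case p of (\<alpha>, \<beta>) \<Rightarrow> c \<alpha> * c' \<beta>) * (\<Prod>v\<in>V. v t ^ add p v))"
      by (intro sum.cong) (auto simp: add_def power_add prod.distrib ac_simps)
    also have "\<dots> = (\<Sum>\<gamma>\<in>V \<rightarrow>\<^sub>E {..e + e'}. \<Sum>p\<in>{p\<in>S. add p = \<gamma>}.
        (case p of (\<alpha>, \<beta>) \<Rightarrow> c \<alpha> * c' \<beta>) * (\<Prod>v\<in>V. v t ^ add p v))"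
      using img finS V by (intro sum.group [symmetric]) (auto intro!: finite_PiE)
    also have "\<dots> = (\<Sum>\<gamma>\<in>V \<rightarrow>\<^sub>E {..e + e'}. q \<gamma> * (\<Prod>v\<in>V. v t ^ \<gamma> v))"
      by (intro sum.cong refl) (simp add: q_def sum_distrib_right)
    finally show ?thesis .
  qed
  then show ?thesis unfolding polynomial_in_def by blast
qed

lemma polynomial_in_power:
  assumes "finite V" and "polynomial_in V G e f"
  shows "polynomial_in V G (k * e) (\<lambda>t. f t ^ k)"
  by (induction k) (use assms in \<open>auto intro: polynomial_in_const polynomial_in_mult\<close>)

text \<open>
  \<open>f\<close> is a polynomial divided by \<open>D ^ e\<close>.  The degree bound \<open>2 * e\<close> is chosen because it is
  additive in \<open>e\<close> and, for \<open>D\<close> of degree \<open>1\<close>, grows at least as fast as the degree of \<open>D ^ e\<close>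
  and for \<open>e = 1\<close> leaves room for a variable times \<open>D\<close>.
\<close>

definition rational_in ::
    "('x \<Rightarrow> 'a::comm_ring_1) set \<Rightarrow> ('x \<Rightarrow> 'a) \<Rightarrow> 'x set \<Rightarrow> nat \<Rightarrow> ('x \<Rightarrow> 'a) \<Rightarrow> bool" where
  "rational_in V D G e f \<longleftrightarrow> polynomial_in V G (2 * e) (\<lambda>t. f t * D t ^ e)"

context
  fixes V :: "('x \<Rightarrow> 'a::field) set" and D :: "'x \<Rightarrow> 'a" and G :: "'x set"
  assumes V: "finite V" and D: "polynomial_in V G 1 D"
begin

lemma rational_in_mono:
  assumes "rational_in V D G e f" and "e \<le> e'"
  shows "rational_in V D G e' f"
proof -
  have "polynomial_in V G (2 * e + (e' - e) * 1) (\<lambda>t. (f t * D t ^ e) * D t ^ (e' - e))"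
    using assms V D unfolding rational_in_def by (intro polynomial_in_mult polynomial_in_power)
  then have "polynomial_in V G (2 * e') (\<lambda>t. (f t * D t ^ e) * D t ^ (e' - e))"
    using V assms(2) by (elim polynomial_in_mono[rotated]) auto
  then show ?thesis
    using assms(2) unfolding rational_in_def by (simp add: mult.assoc power_add [symmetric])
qed

lemma rational_in_mult:
  assumes "rational_in V D G e f" and "rational_in V D G e' g"
  shows "rational_in V D G (e + e') (\<lambda>t. f t * g t)"
  using polynomial_in_mult[OF V assms[unfolded rational_in_def]]
  unfolding rational_in_def by (simp add: power_add ac_simps distrib_left)

lemma rational_in_prod_power:
  assumes "finite A" and "\<And>i. i \<in> A \<Longrightarrow> rational_in V D G e (f i)"
  shows "rational_in V D G (e * (\<Sum>i\<in>A. \<alpha> i)) (\<lambda>t. \<Prod>i\<in>A. f i t ^ \<alpha> i)"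
  using assms
proof (induction A rule: finite_induct)
  case empty
  then show ?case using V by (simp add: rational_in_def polynomial_in_const)
next
  case (insert i A)
  have "rational_in V D G (e * k) (\<lambda>t. f i t ^ k)" for k
  proof (induction k)
    case 0
    then show ?case using V by (simp add: rational_in_def polynomial_in_const)
  next
    case (Suc k)
    then show ?case using insert.prems[of i] rational_in_mult[of e "f i"] by simp
  qed
  from rational_in_mult[OF this insert.IH] show ?case
    using insert by (simp add: distrib_left)
qed

end

text \<open>
  A family of \<open>card M\<close> functions that depend rationally on fewer quantities satisfies a non-trivial
  polynomial relation: the number of monomials with exponents below \<open>L\<close> in the family is \<open>L ^ card M\<close>,
  while after multiplication by a common denominator these monomials are combinations of
  \<open>O(L ^ card (V c))\<close> monomials in the quantities.  As the count has room to spare, the same relation can be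
  imposed for finitely many families at once.
\<close>

lemma dimension_bound:
  fixes \<phi> :: "'c \<Rightarrow> 'i \<Rightarrow> 'x \<Rightarrow> 'a::field"
  assumes M: "finite M" and C: "finite C"
    and V: "\<And>c. c \<in> C \<Longrightarrow> finite (V c)" "\<And>c. c \<in> C \<Longrightarrow> card (V c) < card M"
    and D: "\<And>c. c \<in> C \<Longrightarrow> polynomial_in (V c) (G c) 1 (D c)"
      "\<And>c t. c \<in> C \<Longrightarrow> t \<in> G c \<Longrightarrow> D c t \<noteq> 0"
    and \<phi>: "\<And>c i. c \<in> C \<Longrightarrow> i \<in> M \<Longrightarrow> \<exists>e. rational_in (V c) (D c) (G c) e (\<phi> c i)"
  obtains L q where "\<exists>\<alpha>\<in>M \<rightarrow>\<^sub>E {..<L}. q \<alpha> \<noteq> (0::'a)"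
    and "\<And>c t. c \<in> C \<Longrightarrow> t \<in> G c \<Longrightarrow>
           (\<Sum>\<alpha>\<in>M \<rightarrow>\<^sub>E {..<L}. q \<alpha> * (\<Prod>i\<in>M. \<phi> c i t ^ \<alpha> i)) = 0"
proof -
  obtain e0 where e0: "\<And>c i. c \<in> C \<Longrightarrow> i \<in> M \<Longrightarrow> rational_in (V c) (D c) (G c) (e0 c i) (\<phi> c i)"
    using \<phi> by metis
  define e where "e = (\<Sum>c\<in>C. \<Sum>i\<in>M. e0 c i)"
  have e: "rational_in (V c) (D c) (G c) e (\<phi> c i)" if "c \<in> C" "i \<in> M" for c i
  proof (rule rational_in_mono[OF V(1) D(1) e0])
    have "e0 c i \<le> (\<Sum>i\<in>M. e0 c i)" using that M by (intro member_le_sum) auto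
    also have "\<dots> \<le> e" unfolding e_def using that C by (intro member_le_sum) auto
    finally show "e0 c i \<le> e" .
  qed (use that in auto)
  define m where "m = card M"
  \<comment> \<open>\<open>2 * E + 1 \<le> K * L\<close> makes \<open>(K * L) ^ (m - 1)\<close> a bound for the number of equations per family;
      \<open>L\<close> is the first value for which \<open>L ^ m\<close> exceeds the total.\<close>
  define K where "K = 2 * e * m + 1"
  define L where "L = card C * K ^ (m - 1) + 1"
  define E where "E = e * (m * L)"
  define A where "A = (M \<rightarrow>\<^sub>E {..<L})"
  define B where "B = (SIGMA c:C. V c \<rightarrow>\<^sub>E {..2 * E})"
  define P where "P = (\<lambda>c \<alpha> b. \<forall>t\<in>G c. (\<Prod>i\<in>M. \<phi> c i t ^ \<alpha> i) * D c t ^ E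
          = (\<Sum>\<beta>\<in>V c \<rightarrow>\<^sub>E {..2 * E}. b \<beta> * (\<Prod>v\<in>V c. v t ^ \<beta> v)))"
  define b where "b = (\<lambda>c \<alpha>. SOME b. P c \<alpha> b)"
  have "\<exists>b. P c \<alpha> b"
    if c: "c \<in> C" and \<alpha>: "\<alpha> \<in> A" for c \<alpha>
  proof -
    have "(\<Sum>i\<in>M. \<alpha> i) \<le> (\<Sum>i\<in>M. L)"
      using \<alpha> by (intro sum_mono) (auto simp: A_def PiE_iff less_imp_le)
    then have "e * (\<Sum>i\<in>M. \<alpha> i) \<le> E" by (simp add: E_def m_def)
    moreover have "rational_in (V c) (D c) (G c) (e * (\<Sum>i\<in>M. \<alpha> i)) (\<lambda>t. \<Prod>i\<in>M. \<phi> c i t ^ \<alpha> i)"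
      using c by (intro rational_in_prod_power V D M e)
    ultimately have "rational_in (V c) (D c) (G c) E (\<lambda>t. \<Prod>i\<in>M. \<phi> c i t ^ \<alpha> i)"
      using rational_in_mono[OF V(1) D(1)] c by blast
    then show ?thesis by (simp add: rational_in_def polynomial_in_def P_def)
  qed
  then have "P c \<alpha> (b c \<alpha>)" if "c \<in> C" "\<alpha> \<in> A" for c \<alpha>
    unfolding b_def using that someI_ex[of "P c \<alpha>"] by blast
  then have b: "\<And>c \<alpha> t. c \<in> C \<Longrightarrow> \<alpha> \<in> A \<Longrightarrow> t \<in> G c \<Longrightarrow>
      (\<Prod>i\<in>M. \<phi> c i t ^ \<alpha> i) * D c t ^ E
          = (\<Sum>\<beta>\<in>V c \<rightarrow>\<^sub>E {..2 * E}. b c \<alpha> \<beta> * (\<Prod>v\<in>V c. v t ^ \<beta> v))"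
    by (simp add: P_def)
  have finA: "finite A" and finB: "finite B"
    unfolding A_def B_def using M C V(1) by (auto intro!: finite_PiE finite_SigmaI)
  have "card B < card A"
  proof (cases "C = {}")
    case True
    then have "B = {}" by (simp add: B_def)
    moreover have "card A = L ^ m" by (simp add: A_def card_PiE[OF M] m_def)
    ultimately show ?thesis by (simp add: L_def)
  next
    case False
    then obtain c0 where "c0 \<in> C" by blast
    then have m: "m = Suc (m - 1)" using V(2)[of c0] by (simp add: m_def)
    have "card (V c \<rightarrow>\<^sub>E {..2 * E}) \<le> (K * L) ^ (m - 1)" if "c \<in> C" for c
    proof -
      have "card (V c \<rightarrow>\<^sub>E {..2 * E}) = (2 * E + 1) ^ card (V c)"
        using V(1)[OF that] by (simp add: card_PiE)
      also have "\<dots> \<le> (2 * E + 1) ^ (m - 1)"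
        using V(2)[OF that] by (intro power_increasing) (auto simp: m_def)
      also have "2 * E + 1 \<le> K * L" by (simp add: E_def K_def L_def algebra_simps)
      then have "(2 * E + 1) ^ (m - 1) \<le> (K * L) ^ (m - 1)" by (intro power_mono) auto
      finally show ?thesis .
    qed
    then have "(\<Sum>c\<in>C. card (V c \<rightarrow>\<^sub>E {..2 * E})) \<le> (\<Sum>c\<in>C. (K * L) ^ (m - 1))"
      by (intro sum_mono)
    moreover have "card B = (\<Sum>c\<in>C. card (V c \<rightarrow>\<^sub>E {..2 * E}))"
      unfolding B_def using C V(1) by (intro card_SigmaI) (auto intro!: finite_PiE)
    ultimately have "card B \<le> (\<Sum>c\<in>C. (K * L) ^ (m - 1))" by simp
    also have "\<dots> = (card C * K ^ (m - 1)) * L ^ (m - 1)" by (simp add: power_mult_distrib)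
    also have "\<dots> < L * L ^ (m - 1)" by (intro mult_strict_right_mono) (auto simp: L_def)
    also have "\<dots> = L ^ m" using m by (metis power_Suc)
    also have "\<dots> = card A" by (simp add: A_def card_PiE[OF M] m_def)
    finally show ?thesis .
  qed
  from underdetermined_system[OF finB finA this, of "\<lambda>(c, \<beta>) \<alpha>. b c \<alpha> \<beta>"]
  obtain q where q: "\<exists>\<alpha>\<in>A. q \<alpha> \<noteq> 0"
    "\<And>c \<beta>. c \<in> C \<Longrightarrow> \<beta> \<in> V c \<rightarrow>\<^sub>E {..2 * E} \<Longrightarrow> (\<Sum>\<alpha>\<in>A. b c \<alpha> \<beta> * q \<alpha>) = 0"
    by (auto simp: B_def)
  have "(\<Sum>\<alpha>\<in>A. q \<alpha> * (\<Prod>i\<in>M. \<phi> c i t ^ \<alpha> i)) = 0" if c: "c \<in> C" and t: "t \<in> G c" for c t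
  proof -
    have "(\<Sum>\<alpha>\<in>A. q \<alpha> * (\<Prod>i\<in>M. \<phi> c i t ^ \<alpha> i)) * D c t ^ E
        = (\<Sum>\<alpha>\<in>A. q \<alpha> * ((\<Prod>i\<in>M. \<phi> c i t ^ \<alpha> i) * D c t ^ E))"
      by (simp add: sum_distrib_right mult.assoc)
    also have "\<dots> = (\<Sum>\<alpha>\<in>A. \<Sum>\<beta>\<in>V c \<rightarrow>\<^sub>E {..2 * E}. b c \<alpha> \<beta> * q \<alpha> * (\<Prod>v\<in>V c. v t ^ \<beta> v))"
      using b[OF c _ t] by (intro sum.cong refl) (simp add: sum_distrib_left ac_simps)
    also have "\<dots> = (\<Sum>\<beta>\<in>V c \<rightarrow>\<^sub>E {..2 * E}. \<Sum>\<alpha>\<in>A. b c \<alpha> \<beta> * q \<alpha> * (\<Prod>v\<in>V c. v t ^ \<beta> v))"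
      by (rule sum.swap)
    also have "\<dots> = 0" using q(2)[OF c] by (simp add: sum_distrib_right [symmetric])
    finally show ?thesis using D(2)[OF c t] by simp
  qed
  with q(1) show ?thesis using that[of L q] by (simp add: A_def)
qed

text \<open>
  One coordinate at a time: once the other coordinates make some coefficient of the last variable
  non-zero, only finitely many values of that variable are excluded.
\<close>

lemma polynomial_nonzero_nearby:
  fixes q :: "('i \<Rightarrow> nat) \<Rightarrow> complex" and x0 :: "'i \<Rightarrow> real"
  assumes "finite M" and "\<exists>\<alpha>\<in>M \<rightarrow>\<^sub>E {..<L}. q \<alpha> \<noteq> 0" and "\<epsilon> > 0"
  shows "\<exists>x. (\<forall>i\<in>M. \<bar>x i - x0 i\<bar> < \<epsilon>) \<and>
     (\<Sum>\<alpha>\<in>M \<rightarrow>\<^sub>E {..<L}. q \<alpha> * (\<Prod>i\<in>M. complex_of_real (x i) ^ \<alpha> i)) \<noteq> 0"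
  using assms(1,2)
proof (induction M arbitrary: q rule: finite_induct)
  case empty
  then show ?case by auto
next
  case (insert i M)
  let ?A = "M \<rightarrow>\<^sub>E {..<L}"
  have sum_insert: "(\<Sum>\<alpha>\<in>insert i M \<rightarrow>\<^sub>E {..<L}. q \<alpha> * (\<Prod>k\<in>insert i M. complex_of_real (x k) ^ \<alpha> k))
      = (\<Sum>j<L. (\<Sum>\<alpha>\<in>?A. q (\<alpha>(i := j)) * (\<Prod>k\<in>M. complex_of_real (x k) ^ \<alpha> k)) * complex_of_real (x i) ^ j)"
    for x :: "'i \<Rightarrow> real"
  proof -
    have inj: "inj_on (\<lambda>(y, g). g(i := y)) ({..<L} \<times> ?A)"
      using insert.hyps(2) by (rule inj_combinator)
    have "(\<Sum>\<alpha>\<in>insert i M \<rightarrow>\<^sub>E {..<L}. q \<alpha> * (\<Prod>k\<in>insert i M. complex_of_real (x k) ^ \<alpha> k))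
      = (\<Sum>(j, \<alpha>)\<in>{..<L} \<times> ?A. q (\<alpha>(i := j)) * (\<Prod>k\<in>insert i M. complex_of_real (x k) ^ (\<alpha>(i := j)) k))"
      unfolding PiE_insert_eq sum.reindex[OF inj] by (simp add: o_def case_prod_unfold)
    also have "\<dots> = (\<Sum>(j, \<alpha>)\<in>{..<L} \<times> ?A. q (\<alpha>(i := j)) * (\<Prod>k\<in>M. complex_of_real (x k) ^ \<alpha> k) * complex_of_real (x i) ^ j)"
    proof -
      have "(\<Prod>k\<in>M. complex_of_real (x k) ^ (\<alpha>(i := j)) k) = (\<Prod>k\<in>M. complex_of_real (x k) ^ \<alpha> k)" for \<alpha> j
        using insert.hyps by (intro prod.cong) auto
      then show ?thesis using insert.hyps by (intro sum.cong) auto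
    qed
    also have "\<dots> = (\<Sum>j<L. \<Sum>\<alpha>\<in>?A. q (\<alpha>(i := j)) * (\<Prod>k\<in>M. complex_of_real (x k) ^ \<alpha> k) * complex_of_real (x i) ^ j)"
      by (simp add: sum.cartesian_product)
    finally show ?thesis by (simp add: sum_distrib_right)
  qed
  obtain \<alpha> where \<alpha>: "\<alpha> \<in> insert i M \<rightarrow>\<^sub>E {..<L}" "q \<alpha> \<noteq> 0" using insert.prems by blast
  define j where "j = \<alpha> i"
  have j: "j < L" using \<alpha> by (auto simp: j_def)
  have "\<exists>\<beta>\<in>?A. q (\<beta>(i := j)) \<noteq> 0"
  proof (intro bexI)
    show "\<alpha>(i := undefined) \<in> ?A" using \<alpha> insert.hyps by (auto simp: PiE_iff extensional_def)
    show "q (\<alpha>(i := undefined, i := j)) \<noteq> 0" using \<alpha> by (simp add: j_def)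
  qed
  from insert.IH[of "\<lambda>\<beta>. q (\<beta>(i := j))", OF this]
  obtain x where x: "\<forall>k\<in>M. \<bar>x k - x0 k\<bar> < \<epsilon>"
    and nz: "(\<Sum>\<alpha>\<in>?A. q (\<alpha>(i := j)) * (\<Prod>k\<in>M. complex_of_real (x k) ^ \<alpha> k)) \<noteq> 0" by blast
  define r where "r = (\<lambda>j. \<Sum>\<alpha>\<in>?A. q (\<alpha>(i := j)) * (\<Prod>k\<in>M. complex_of_real (x k) ^ \<alpha> k))"
  define R where "R = (\<Sum>j<L. Polynomial.monom (r j) j)"
  have "coeff R j = r j" using j by (simp add: R_def coeff_sum)
  then have "R \<noteq> 0" using nz by (auto simp: r_def)
  then have "finite {c. poly R c = 0}" by (rule poly_roots_finite)
  then have "finite (complex_of_real -` {c. poly R c = 0})"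
    by (rule finite_vimageI) (auto simp: inj_def)
  moreover have "infinite {x0 i <..< x0 i + \<epsilon>}" using assms(3) by simp
  ultimately obtain c where c: "c \<in> {x0 i <..< x0 i + \<epsilon>}" "poly R (complex_of_real c) \<noteq> 0"
    by (metis (mono_tags, lifting) finite_subset mem_Collect_eq subsetI vimageI)
  have same: "(\<Sum>\<alpha>\<in>?A. q (\<alpha>(i := k)) * (\<Prod>l\<in>M. complex_of_real ((x(i := c)) l) ^ \<alpha> l)) = r k" for k
  proof -
    have "(\<Prod>l\<in>M. complex_of_real ((x(i := c)) l) ^ \<alpha> l) = (\<Prod>l\<in>M. complex_of_real (x l) ^ \<alpha> l)" for \<alpha> :: "'i \<Rightarrow> nat"
      using insert.hyps by (intro prod.cong) auto
    then show ?thesis by (simp add: r_def)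
  qed
  show ?case
  proof (intro exI conjI ballI)
    fix k assume "k \<in> insert i M"
    then show "\<bar>(x(i := c)) k - x0 k\<bar> < \<epsilon>" using x c(1) by auto
  next
    have "(\<Sum>j<L. r j * complex_of_real c ^ j) = poly R (complex_of_real c)"
      by (simp add: R_def poly_sum poly_monom)
    then show "(\<Sum>\<alpha>\<in>insert i M \<rightarrow>\<^sub>E {..<L}. q \<alpha> *
        (\<Prod>k\<in>insert i M. complex_of_real ((x(i := c)) k) ^ \<alpha> k)) \<noteq> 0"
      unfolding sum_insert same using c(2) by simp
  qed
qed

text \<open>
  With the exponent of the denominator forgotten, rational functions form a ring that contains
  the variables and the inverse of \<open>D\<close>.
\<close>

definition rational_fn :: "('x \<Rightarrow> 'a::field) set \<Rightarrow> ('x \<Rightarrow> 'a) \<Rightarrow> 'x set \<Rightarrow> ('x \<Rightarrow> 'a) \<Rightarrow> bool" where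
  "rational_fn V D G f \<longleftrightarrow> (\<exists>e. rational_in V D G e f)"

lemma rational_fn_cong:
  assumes "\<And>t. t \<in> G \<Longrightarrow> f t = g t" and "rational_fn V D G g"
  shows "rational_fn V D G f"
proof -
  obtain e where "polynomial_in V G (2 * e) (\<lambda>t. g t * D t ^ e)"
    using assms(2) unfolding rational_fn_def rational_in_def by blast
  then have "polynomial_in V G (2 * e) (\<lambda>t. f t * D t ^ e)"
    by (rule polynomial_in_cong[THEN iffD2, rotated]) (simp add: assms(1))
  then show ?thesis unfolding rational_fn_def rational_in_def by blast
qed

context
  fixes V :: "('x \<Rightarrow> 'a::field) set" and D :: "'x \<Rightarrow> 'a" and G :: "'x set"
  assumes V: "finite V" and D: "polynomial_in V G 1 D" and D0: "\<And>t. t \<in> G \<Longrightarrow> D t \<noteq> 0"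
begin

lemma rational_fn_const: "rational_fn V D G (\<lambda>_. a)"
  unfolding rational_fn_def rational_in_def
  using polynomial_in_const[OF V] by (intro exI[of _ 0]) simp

lemma rational_fn_var:
  assumes "v \<in> V" shows "rational_fn V D G v"
  using polynomial_in_mult[OF V polynomial_in_var[OF V assms] D]
  unfolding rational_fn_def rational_in_def by (intro exI[of _ 1]) (simp add: numeral_2_eq_2)

lemma rational_fn_inverse_D: "rational_fn V D G (\<lambda>t. 1 / D t)"
proof -
  have "polynomial_in V G 2 (\<lambda>_. 1)"
    using polynomial_in_mono[OF V polynomial_in_const[OF V]] by blast
  then have "polynomial_in V G 2 (\<lambda>t. 1 / D t * D t ^ 1)"
    by (subst polynomial_in_cong[of G _ "\<lambda>_. 1"]) (use D0 in auto)
  then show ?thesis unfolding rational_fn_def rational_in_def by (intro exI[of _ 1]) simp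
qed

lemma rational_fn_mult:
  assumes "rational_fn V D G f" and "rational_fn V D G g"
  shows "rational_fn V D G (\<lambda>t. f t * g t)"
  using assms rational_in_mult[OF V D] unfolding rational_fn_def by blast

lemma rational_fn_add:
  assumes "rational_fn V D G f" and "rational_fn V D G g"
  shows "rational_fn V D G (\<lambda>t. f t + g t)"
proof -
  obtain a b where "rational_in V D G a f" "rational_in V D G b g"
    using assms unfolding rational_fn_def by blast
  then have "rational_in V D G (max a b) f" "rational_in V D G (max a b) g"
    using rational_in_mono[OF V D] by (meson max.cobounded1, meson max.cobounded2)
  then have "rational_in V D G (max a b) (\<lambda>t. f t + g t)"
    using polynomial_in_add unfolding rational_in_def by (fastforce simp: distrib_right)
  then show ?thesis unfolding rational_fn_def by blast
qed

lemma rational_fn_uminus: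
  assumes "rational_fn V D G f" shows "rational_fn V D G (\<lambda>t. - f t)"
  using rational_fn_mult[OF rational_fn_const[of "-1"] assms] by simp

lemma rational_fn_diff:
  assumes "rational_fn V D G f" and "rational_fn V D G g"
  shows "rational_fn V D G (\<lambda>t. f t - g t)"
  using rational_fn_add[OF assms(1) rational_fn_uminus[OF assms(2)]] by simp

lemma rational_fn_divide_D:
  assumes "rational_fn V D G f" shows "rational_fn V D G (\<lambda>t. f t / D t)"
  using rational_fn_mult[OF assms rational_fn_inverse_D] by simp

lemma rational_fn_power:
  assumes "rational_fn V D G f" shows "rational_fn V D G (\<lambda>t. f t ^ k)"
  by (induction k) (auto intro: rational_fn_const rational_fn_mult assms)

lemma rational_fn_sum:
  assumes "\<And>i. i \<in> A \<Longrightarrow> rational_fn V D G (f i)"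
  shows "rational_fn V D G (\<lambda>t. \<Sum>i\<in>A. f i t)"
  using assms
  by (induction A rule: infinite_finite_induct) (auto intro: rational_fn_const rational_fn_add)

lemma rational_fn_prod:
  assumes "\<And>i. i \<in> A \<Longrightarrow> rational_fn V D G (f i)"
  shows "rational_fn V D G (\<lambda>t. \<Prod>i\<in>A. f i t)"
  using assms
  by (induction A rule: infinite_finite_induct) (auto intro: rational_fn_const rational_fn_mult)

end

section \<open>Values and gradients of forms\<close>

definition monoms :: "nat \<Rightarrow> nat \<Rightarrow> nat monom set" where
  "monoms n d = {m. Poly_Mapping.keys m \<subseteq> {..<n} \<and> monom_degree m = d}"

definition mon_eval :: "nat \<Rightarrow> (nat \<Rightarrow> 'a::comm_semiring_1) \<Rightarrow> nat monom \<Rightarrow> 'a" where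
  "mon_eval n x m = (\<Prod>i<n. x i ^ Poly_Mapping.lookup m i)"

lemma monom_degree_eq:
  fixes m :: "nat monom"
  assumes "Poly_Mapping.keys m \<subseteq> {..<n}"
  shows "monom_degree m = (\<Sum>i<n. Poly_Mapping.lookup m i)"
  unfolding monom_degree_def using assms
  by (intro sum.mono_neutral_left finite_lessThan) (auto simp: in_keys_iff)

lemma finite_monoms: "finite (monoms n d)"
proof (rule inj_on_finite)
  show "inj_on (\<lambda>m. \<lambda>i\<in>{..<n}. Poly_Mapping.lookup m i) (monoms n d)"
  proof (rule inj_onI, rule poly_mapping_eqI)
    fix a b :: "nat monom" and k
    assume ab: "a \<in> monoms n d" "b \<in> monoms n d"
      and eq: "(\<lambda>i\<in>{..<n}. Poly_Mapping.lookup a i) = (\<lambda>i\<in>{..<n}. Poly_Mapping.lookup b i)"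
    show "Poly_Mapping.lookup a k = Poly_Mapping.lookup b k"
    proof (cases "k < n")
      case True
      then show ?thesis using fun_cong[OF eq, of k] by simp
    next
      case False
      then have "k \<notin> Poly_Mapping.keys a" "k \<notin> Poly_Mapping.keys b" using ab by (auto simp: monoms_def)
      then show ?thesis by (simp add: in_keys_iff)
    qed
  qed
  show "(\<lambda>m. \<lambda>i\<in>{..<n}. Poly_Mapping.lookup m i) ` monoms n d \<subseteq> {..<n} \<rightarrow>\<^sub>E {..d}"
  proof (intro image_subsetI restrict_PiE_iff [THEN iffD2] ballI)
    fix m i assume "m \<in> monoms n d" "i \<in> {..<n}"
    then show "Poly_Mapping.lookup m i \<in> {..d}"
      using member_le_sum[of i "{..<n}" "Poly_Mapping.lookup m"] by (auto simp: monoms_def monom_degree_eq)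
  qed
  show "finite ({..<n} \<rightarrow>\<^sub>E {..d})" by (simp add: finite_PiE)
qed

lemma forms_iff: "F \<in> forms n d \<longleftrightarrow> Poly_Mapping.keys F \<subseteq> monoms n d"
  by (auto simp: forms_def vars_def homogeneous_def monoms_def)

lemma mon_eval_keys:
  assumes "Poly_Mapping.keys m \<subseteq> {..<n}"
  shows "(\<Prod>i\<in>Poly_Mapping.keys m. x i ^ Poly_Mapping.lookup m i) = mon_eval n x m"
  unfolding mon_eval_def using assms
  by (intro prod.mono_neutral_left) (auto simp: in_keys_iff)

lemma eval_form_superset:
  assumes "finite S" and "Poly_Mapping.keys p \<subseteq> S"
  shows "eval_form p x = (\<Sum>m\<in>S. Poly_Mapping.lookup p m * (\<Prod>i\<in>Poly_Mapping.keys m. x i ^ Poly_Mapping.lookup m i))"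
  unfolding eval_mpoly_def using assms
  by (intro sum.mono_neutral_left) (auto simp: in_keys_iff)

lemma eval_form_add: "eval_form (p + q) x = eval_form p x + eval_form q x"
proof -
  let ?S = "Poly_Mapping.keys p \<union> Poly_Mapping.keys q"
  have "finite ?S" by simp
  note eq = eval_form_superset[OF this, of _ x]
  show ?thesis
    using eq[of p] eq[of q] eq[OF keys_add] by (simp add: lookup_add distrib_right sum.distrib)
qed

lemma eval_form_sum: "eval_form (\<Sum>i\<in>A. p i) x = (\<Sum>i\<in>A. eval_form (p i) x)"
  by (induction A rule: infinite_finite_induct) (simp_all add: eval_form_add, simp_all add: eval_mpoly_def)

lemma eval_form_single:
  assumes "Poly_Mapping.keys m \<subseteq> {..<n}"
  shows "eval_form (Poly_Mapping.single m c) x = c * mon_eval n x m"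
  using mon_eval_keys[OF assms, of x] by (simp add: eval_mpoly_def)

lemma mon_eval_add: "mon_eval n x (a + b) = mon_eval n x a * mon_eval n x b"
  by (simp add: mon_eval_def lookup_add power_add prod.distrib)

lemma mon_eval_single:
  assumes "k < n" shows "mon_eval n x (Poly_Mapping.single k e) = x k ^ e"
proof -
  have "mon_eval n x (Poly_Mapping.single k e) = (\<Prod>i<n. if i = k then x i ^ e else 1)"
    unfolding mon_eval_def by (intro prod.cong) (auto simp: lookup_single when_def)
  then show ?thesis using assms by simp
qed

text \<open>
  Value and partial derivatives of the form with coefficients \<open>h\<close>, as sums over all
  monomials of degree \<open>d\<close>, so that they are visibly linear in \<open>h\<close>.
\<close>

definition form_value :: "nat \<Rightarrow> nat \<Rightarrow> (nat monom \<Rightarrow> 'a::comm_semiring_1) \<Rightarrow> (nat \<Rightarrow> 'a) \<Rightarrow> 'a" where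
  "form_value n d h x = (\<Sum>m\<in>monoms n d. h m * mon_eval n x m)"

definition form_gradient :: "nat \<Rightarrow> nat \<Rightarrow> (nat monom \<Rightarrow> 'a::comm_semiring_1) \<Rightarrow> (nat \<Rightarrow> 'a) \<Rightarrow> nat \<Rightarrow> 'a" where
  "form_gradient n d h x k = (\<Sum>m\<in>monoms n d. of_nat (Poly_Mapping.lookup m k) * h m *
     mon_eval n x (m - Poly_Mapping.single k 1))"

lemma eval_form_eq_val:
  assumes "F \<in> forms n d"
  shows "eval_form F x = form_value n d (Poly_Mapping.lookup F) x"
proof -
  have "Poly_Mapping.keys F \<subseteq> monoms n d" using assms by (simp add: forms_iff)
  from eval_form_superset[OF finite_monoms this, of x] show ?thesis
    unfolding form_value_def by (auto simp: monoms_def mon_eval_keys intro!: sum.cong)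
qed

lemma eval_partial_deriv_eq_grad:
  assumes "F \<in> forms n d"
  shows "eval_form (partial_deriv k F) x = form_gradient n d (Poly_Mapping.lookup F) x k"
proof -
  have F: "Poly_Mapping.keys F \<subseteq> monoms n d" using assms by (simp add: forms_iff)
  have "Poly_Mapping.keys (m - Poly_Mapping.single k 1) \<subseteq> {..<n}" if "m \<in> Poly_Mapping.keys F" for m
  proof -
    have "Poly_Mapping.keys (m - Poly_Mapping.single k 1) \<subseteq> Poly_Mapping.keys m"
      by (auto simp: in_keys_iff lookup_minus)
    then show ?thesis using that F by (auto simp: monoms_def)
  qed
  then have "eval_form (partial_deriv k F) x
      = (\<Sum>m\<in>Poly_Mapping.keys F. of_nat (Poly_Mapping.lookup m k) * Poly_Mapping.lookup F m *
           mon_eval n x (m - Poly_Mapping.single k 1))"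
    unfolding partial_deriv_def eval_form_sum by (intro sum.cong refl eval_form_single)
  also have "\<dots> = form_gradient n d (Poly_Mapping.lookup F) x k"
    unfolding form_gradient_def using F
    by (intro sum.mono_neutral_left finite_monoms) (auto simp: in_keys_iff)
  finally show ?thesis .
qed

lemma mon_eval_minus_single:
  assumes "k < n" and "Poly_Mapping.lookup m k > 0"
  shows "x k * mon_eval n x (m - Poly_Mapping.single k 1) = mon_eval n x m"
proof -
  let ?m' = "m - Poly_Mapping.single k 1"
  have split: "mon_eval n x a = x k ^ Poly_Mapping.lookup a k * (\<Prod>i\<in>{..<n} - {k}. x i ^ Poly_Mapping.lookup a i)" for a
    unfolding mon_eval_def using assms(1) by (intro prod.remove) auto
  have "(\<Prod>i\<in>{..<n} - {k}. x i ^ Poly_Mapping.lookup ?m' i) = (\<Prod>i\<in>{..<n} - {k}. x i ^ Poly_Mapping.lookup m i)"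
    by (intro prod.cong) (auto simp: lookup_minus lookup_single)
  moreover have "Poly_Mapping.lookup m k = Suc (Poly_Mapping.lookup ?m' k)"
    using assms(2) by (simp add: lookup_minus)
  ultimately show ?thesis unfolding split by (simp add: mult.assoc)
qed

lemma euler_identity: "(\<Sum>k<n. x k * form_gradient n d h x k) = of_nat d * form_value n d h x"
proof -
  have "(\<Sum>k<n. x k * form_gradient n d h x k)
      = (\<Sum>m\<in>monoms n d. \<Sum>k<n. of_nat (Poly_Mapping.lookup m k) * (h m * (x k * mon_eval n x (m - Poly_Mapping.single k 1))))"
    unfolding form_gradient_def sum_distrib_left by (subst sum.swap) (simp add: ac_simps)
  also have "\<dots> = (\<Sum>m\<in>monoms n d. \<Sum>k<n. of_nat (Poly_Mapping.lookup m k) * (h m * mon_eval n x m))"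
  proof (intro sum.cong refl)
    fix m k assume "k \<in> {..<n}"
    then show "of_nat (Poly_Mapping.lookup m k) * (h m * (x k * mon_eval n x (m - Poly_Mapping.single k 1)))
        = of_nat (Poly_Mapping.lookup m k) * (h m * mon_eval n x m)"
      using mon_eval_minus_single[of k n m x] by (cases "Poly_Mapping.lookup m k = 0") auto
  qed
  also have "\<dots> = (\<Sum>m\<in>monoms n d. of_nat d * (h m * mon_eval n x m))"
    by (intro sum.cong refl)
       (auto simp: monoms_def monom_degree_eq sum_distrib_right [symmetric] of_nat_sum [symmetric] simp del: of_nat_sum)
  finally show ?thesis by (simp add: form_value_def sum_distrib_left)
qed

lemma mon_eval_scale:
  assumes "Poly_Mapping.keys m \<subseteq> {..<n}"
  shows "mon_eval n (\<lambda>i. c * x i) m = c ^ monom_degree m * mon_eval n x m"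
  by (simp add: mon_eval_def monom_degree_eq[OF assms] power_mult_distrib prod.distrib power_sum)

lemma monoms_minus_single:
  assumes m: "m \<in> monoms n d" and pos: "Poly_Mapping.lookup m k \<noteq> 0"
  shows "m - Poly_Mapping.single k 1 \<in> monoms n (d - 1)"
proof -
  let ?m' = "m - Poly_Mapping.single k 1"
  have "Poly_Mapping.keys ?m' \<subseteq> Poly_Mapping.keys m" by (auto simp: in_keys_iff lookup_minus)
  then have m': "Poly_Mapping.keys ?m' \<subseteq> {..<n}" using m by (auto simp: monoms_def)
  have k: "k < n" using pos m unfolding monoms_def by (metis (mono_tags, lifting) in_keys_iff lessThan_iff mem_Collect_eq subsetD)
  have lookup: "Poly_Mapping.lookup m i = Poly_Mapping.lookup ?m' i + of_bool (i = k)" for i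
    using pos by (auto simp: lookup_minus lookup_single when_def)
  have "d = (\<Sum>i<n. Poly_Mapping.lookup m i)"
    using m by (auto simp: monoms_def monom_degree_eq)
  also have "\<dots> = monom_degree ?m' + 1"
    unfolding lookup monom_degree_eq[OF m'] using k by (simp add: sum.distrib)
  finally show ?thesis using m' by (simp add: monoms_def)
qed

lemma grad_scale: "form_gradient n d h (\<lambda>i. c * x i) k = c ^ (d - 1) * form_gradient n d h x k"
  unfolding form_gradient_def sum_distrib_left
proof (intro sum.cong refl)
  fix m assume m: "m \<in> monoms n d"
  let ?m' = "m - Poly_Mapping.single k 1"
  show "of_nat (Poly_Mapping.lookup m k) * h m * mon_eval n (\<lambda>i. c * x i) ?m' =
     c ^ (d - 1) * (of_nat (Poly_Mapping.lookup m k) * h m * mon_eval n x ?m')"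
  proof (cases "Poly_Mapping.lookup m k = 0")
    case False
    from monoms_minus_single[OF m this]
    have "mon_eval n (\<lambda>i. c * x i) ?m' = c ^ (d - 1) * mon_eval n x ?m'"
      using mon_eval_scale[of ?m' n c x] by (simp add: monoms_def)
    then show ?thesis by (simp only: ac_simps)
  qed simp
qed

lemma mon_eval_cong:
  assumes "\<And>i. i < n \<Longrightarrow> x i = y i" shows "mon_eval n x m = mon_eval n y m"
  unfolding mon_eval_def using assms by (intro prod.cong) auto

lemma monoms_degree_1:
  assumes "m \<in> monoms n 1"
  obtains l where "l < n" and "m = Poly_Mapping.single l 1"
proof -
  have sum: "(\<Sum>i<n. Poly_Mapping.lookup m i) = Suc 0"
    using assms by (auto simp: monoms_def monom_degree_eq)
  then obtain l where l: "l < n" "Poly_Mapping.lookup m l = 1"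
    "\<And>i. i < n \<Longrightarrow> i \<noteq> l \<Longrightarrow> Poly_Mapping.lookup m i = 0"
    by (auto simp: sum_eq_Suc0_iff)
  have "Poly_Mapping.lookup m i = 0" if "i \<ge> n" for i
  proof -
    have "i \<notin> Poly_Mapping.keys m" using assms that by (auto simp: monoms_def)
    then show ?thesis by (simp add: in_keys_iff)
  qed
  then have "m = Poly_Mapping.single l 1"
    using l \<open>\<And>i. i \<ge> n \<Longrightarrow> Poly_Mapping.lookup m i = 0\<close>
    by (intro poly_mapping_eqI) (metis lookup_single_eq lookup_single_not_eq not_le)
  then show ?thesis using that l(1) by blast
qed

lemma mon_eval_Re:
  assumes "m \<in> monoms n 1"
  shows "mon_eval n (\<lambda>i. Re (z i)) m = Re (mon_eval n z m)"
proof -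
  obtain l where l: "l < n" "m = Poly_Mapping.single l 1" using monoms_degree_1[OF assms] by blast
  then show ?thesis unfolding l(2) mon_eval_single[OF l(1)] by simp
qed

lemma mon_eval_of_real: "mon_eval n (\<lambda>i. of_real (x i)) m = of_real (mon_eval n x m)"
  by (simp add: mon_eval_def)

lemma grad_of_real: "form_gradient n d (\<lambda>m. of_real (h m)) (\<lambda>i. of_real (x i)) k = of_real (form_gradient n d h x k)"
  by (simp add: form_gradient_def mon_eval_of_real)

lemma grad_cnj: "form_gradient n d (\<lambda>m. complex_of_real (h m)) (\<lambda>i. cnj (z i)) k =
    cnj (form_gradient n d (\<lambda>m. complex_of_real (h m)) z k)"
  by (simp add: form_gradient_def mon_eval_def)

text \<open>For quadratic forms the gradient is linear in the point.\<close>

lemma grad_Re: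
  fixes h :: "nat monom \<Rightarrow> real"
  shows "form_gradient n 2 h (\<lambda>i. Re (z i)) k = Re (form_gradient n 2 (\<lambda>m. complex_of_real (h m)) z k)"
  unfolding form_gradient_def Re_sum
proof (intro sum.cong refl)
  fix m assume m: "m \<in> monoms n 2"
  show "of_nat (Poly_Mapping.lookup m k) * h m * mon_eval n (\<lambda>i. Re (z i)) (m - Poly_Mapping.single k 1)
    = Re (of_nat (Poly_Mapping.lookup m k) * complex_of_real (h m) * mon_eval n z (m - Poly_Mapping.single k 1))"
  proof (cases "Poly_Mapping.lookup m k = 0")
    case False
    from monoms_minus_single[OF m this] have "m - Poly_Mapping.single k 1 \<in> monoms n 1" by simp
    from mon_eval_Re[OF this, of z] show ?thesis
      by simp
  qed simp
qed

section \<open>Forms with two singular points\<close>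

text \<open>
  Let \<open>x\<^sub>i = 1\<close>.  The conditions to be singular at two points with different \<open>j\<close>-th coordinates
  are solved for the coefficients of the monomials \<open>x\<^sub>i^(d-r) x\<^sub>j^r\<close> with \<open>r \<le> 3\<close>, and
  \<open>x\<^sub>i^(d-1) x\<^sub>l\<close> and \<open>x\<^sub>i^(d-2) x\<^sub>j x\<^sub>l\<close> with \<open>l\<close> different from \<open>i\<close> and \<open>j\<close>: the derivative with
  respect to \<open>x\<^sub>l\<close> contains just the last two, as an affine function of \<open>x\<^sub>j\<close>, and the
  value and the derivative with respect to \<open>x\<^sub>j\<close> contain the first four as a cubic in \<open>x\<^sub>j\<close>.
\<close>

definition piv_edge :: "nat \<Rightarrow> nat \<Rightarrow> nat \<Rightarrow> nat \<Rightarrow> nat monom" where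
  "piv_edge d i j r = Poly_Mapping.single i (d - r) + Poly_Mapping.single j r"

definition piv_vertex :: "nat \<Rightarrow> nat \<Rightarrow> nat \<Rightarrow> nat monom" where
  "piv_vertex d i l = Poly_Mapping.single i (d - 1) + Poly_Mapping.single l 1"

definition piv_mixed :: "nat \<Rightarrow> nat \<Rightarrow> nat \<Rightarrow> nat \<Rightarrow> nat monom" where
  "piv_mixed d i j l = Poly_Mapping.single i (d - 2) + Poly_Mapping.single j 1 + Poly_Mapping.single l 1"

definition pivots :: "nat \<Rightarrow> nat \<Rightarrow> nat \<Rightarrow> nat \<Rightarrow> nat monom set" where
  "pivots n d i j = piv_edge d i j ` {..<4} \<union> piv_vertex d i ` ({..<n} - {i, j}) \<union>
     piv_mixed d i j ` ({..<n} - {i, j})"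

definition rest_val ::
    "nat \<Rightarrow> nat \<Rightarrow> nat \<Rightarrow> nat \<Rightarrow> (nat monom \<Rightarrow> 'a::comm_semiring_1) \<Rightarrow> (nat \<Rightarrow> 'a) \<Rightarrow> 'a" where
  "rest_val n d i j h x = (\<Sum>m\<in>monoms n d - pivots n d i j. h m * mon_eval n x m)"

definition rest_grad ::
    "nat \<Rightarrow> nat \<Rightarrow> nat \<Rightarrow> nat \<Rightarrow> (nat monom \<Rightarrow> 'a::comm_semiring_1) \<Rightarrow> (nat \<Rightarrow> 'a) \<Rightarrow> nat \<Rightarrow> 'a" where
  "rest_grad n d i j h x k = (\<Sum>m\<in>monoms n d - pivots n d i j. of_nat (Poly_Mapping.lookup m k) * h m *
     mon_eval n x (m - Poly_Mapping.single k 1))"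

lemmas piv_defs = piv_edge_def piv_vertex_def piv_mixed_def

context
  fixes n d i j :: nat
  assumes ij: "i < n" "j < n" "i \<noteq> j" and d: "d \<ge> 3"
begin

lemma pivots_inj:
  "inj_on (piv_edge d i j) {..<4}"
  "inj_on (piv_vertex d i) ({..<n} - {i, j})"
  "inj_on (piv_mixed d i j) ({..<n} - {i, j})"
proof -
  have "Poly_Mapping.lookup (piv_edge d i j r) j = r" for r
    using ij by (simp add: piv_defs lookup_add lookup_single)
  then show "inj_on (piv_edge d i j) {..<4}" by (metis inj_onI)
  have v: "Poly_Mapping.lookup (piv_vertex d i l) k = of_bool (l = k)" if "k \<noteq> i" for k l
    using ij that by (simp add: piv_defs lookup_add lookup_single when_def)
  show "inj_on (piv_vertex d i) ({..<n} - {i, j})"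
  proof (rule inj_onI)
    fix l k assume "l \<in> {..<n} - {i, j}" "k \<in> {..<n} - {i, j}" "piv_vertex d i l = piv_vertex d i k"
    then show "l = k" using v[of k l] v[of k k] by (cases "l = k") auto
  qed
  have w: "Poly_Mapping.lookup (piv_mixed d i j l) k = of_bool (l = k)" if "k \<noteq> i" "k \<noteq> j" for k l
    using ij that by (simp add: piv_defs lookup_add lookup_single when_def)
  show "inj_on (piv_mixed d i j) ({..<n} - {i, j})"
  proof (rule inj_onI)
    fix l k assume "l \<in> {..<n} - {i, j}" "k \<in> {..<n} - {i, j}" "piv_mixed d i j l = piv_mixed d i j k"
    then show "l = k" using w[of k l] w[of k k] by (cases "l = k") auto
  qed
qed

lemma pivots_disjoint:
  "piv_edge d i j ` {..<4} \<inter> piv_vertex d i ` ({..<n} - {i, j}) = {}"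
  "(piv_edge d i j ` {..<4} \<union> piv_vertex d i ` ({..<n} - {i, j})) \<inter> piv_mixed d i j ` ({..<n} - {i, j}) = {}"
proof -
  have e: "piv_edge d i j r \<noteq> piv_vertex d i l" "piv_edge d i j r \<noteq> piv_mixed d i j l"
    "piv_vertex d i k \<noteq> piv_mixed d i j l"
    if l: "l \<noteq> i" "l \<noteq> j" and k: "k \<noteq> j" for r l k
  proof -
    have "Poly_Mapping.lookup (piv_edge d i j r) l = 0" "Poly_Mapping.lookup (piv_vertex d i l) l = 1"
      "Poly_Mapping.lookup (piv_mixed d i j l) l = 1"
      using l ij by (simp_all add: piv_defs lookup_add lookup_single)
    then show "piv_edge d i j r \<noteq> piv_vertex d i l" "piv_edge d i j r \<noteq> piv_mixed d i j l" by auto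
    have "Poly_Mapping.lookup (piv_vertex d i k) j = 0" "Poly_Mapping.lookup (piv_mixed d i j l) j = 1"
      using l k ij by (simp_all add: piv_defs lookup_add lookup_single when_def)
    then show "piv_vertex d i k \<noteq> piv_mixed d i j l" by auto
  qed
  show "piv_edge d i j ` {..<4} \<inter> piv_vertex d i ` ({..<n} - {i, j}) = {}"
    by (auto dest: e(1)[OF _ _ ij(3)])
  show "(piv_edge d i j ` {..<4} \<union> piv_vertex d i ` ({..<n} - {i, j})) \<inter> piv_mixed d i j ` ({..<n} - {i, j}) = {}"
    by (auto dest: e(2)[OF _ _ ij(3)] e(3))
qed

lemma card_pivots: "card (pivots n d i j) = 2 * n"
proof -
  have "card ({..<n} - {i, j}) = n - 2" using ij by (simp add: card_Diff_subset)
  moreover have "n \<ge> 2" using ij by linarith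
  ultimately show ?thesis
    using pivots_inj pivots_disjoint unfolding pivots_def
    by (simp add: card_Un_disjoint card_image)
qed

lemma pivots_subset: "pivots n d i j \<subseteq> monoms n d"
proof
  fix m assume "m \<in> pivots n d i j"
  then have "(\<forall>k. k \<ge> n \<longrightarrow> Poly_Mapping.lookup m k = 0) \<and> (\<Sum>k<n. Poly_Mapping.lookup m k) = d"
    using ij d by (auto simp: pivots_def piv_defs lookup_add lookup_single when_def sum.distrib)
  then have "Poly_Mapping.keys m \<subseteq> {..<n}" "(\<Sum>k<n. Poly_Mapping.lookup m k) = d"
    by (metis in_keys_iff lessThan_iff not_le subsetI, simp)
  then show "m \<in> monoms n d" by (simp add: monoms_def monom_degree_eq)
qed

lemma sum_mons_pivots:
  fixes g :: "nat monom \<Rightarrow> 'a::comm_monoid_add"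
  shows "sum g (monoms n d) = sum g (monoms n d - pivots n d i j) + ((\<Sum>r<4. g (piv_edge d i j r)) +
     (\<Sum>l\<in>{..<n} - {i, j}. g (piv_vertex d i l)) + (\<Sum>l\<in>{..<n} - {i, j}. g (piv_mixed d i j l)))"
proof -
  have "sum g (pivots n d i j) = (\<Sum>r<4. g (piv_edge d i j r)) +
     (\<Sum>l\<in>{..<n} - {i, j}. g (piv_vertex d i l)) + (\<Sum>l\<in>{..<n} - {i, j}. g (piv_mixed d i j l))"
    using pivots_inj pivots_disjoint unfolding pivots_def
    by (simp add: sum.union_disjoint sum.reindex)
  then show ?thesis using sum.subset_diff[OF pivots_subset finite_monoms, of g] by simp
qed

lemma mon_eval_pivots:
  assumes "x i = 1"
  shows "mon_eval n x (piv_edge d i j r) = x j ^ r"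
    and "l < n \<Longrightarrow> mon_eval n x (piv_vertex d i l) = x l"
    and "l < n \<Longrightarrow> mon_eval n x (piv_mixed d i j l) = x j * x l"
  using assms ij by (simp_all add: piv_defs mon_eval_add mon_eval_single)

lemma val_split:
  assumes "x i = 1"
  shows "form_value n d h x = rest_val n d i j h x + ((\<Sum>r<4. h (piv_edge d i j r) * x j ^ r) +
     (\<Sum>l\<in>{..<n} - {i, j}. (h (piv_vertex d i l) + h (piv_mixed d i j l) * x j) * x l))"
  unfolding form_value_def sum_mons_pivots rest_val_def
  by (simp add: mon_eval_pivots assms sum.distrib algebra_simps)

lemma grad_split_other:
  assumes x: "x i = 1" and k: "k < n" "k \<noteq> i" "k \<noteq> j"
  shows "form_gradient n d h x k = rest_grad n d i j h x k + (h (piv_vertex d i k) + h (piv_mixed d i j k) * x j)"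
proof -
  have l1: "Poly_Mapping.lookup (piv_edge d i j r) k = 0" for r
    using k by (simp add: piv_defs lookup_add lookup_single)
  have l2: "Poly_Mapping.lookup (piv_vertex d i l) k = of_bool (l = k)"
    "Poly_Mapping.lookup (piv_mixed d i j l) k = of_bool (l = k)" for l
    using k by (simp_all add: piv_defs lookup_add lookup_single when_def)
  have m: "piv_vertex d i k - Poly_Mapping.single k 1 = Poly_Mapping.single i (d - 1)"
    "piv_mixed d i j k - Poly_Mapping.single k 1 = Poly_Mapping.single i (d - 2) + Poly_Mapping.single j 1"
    by (simp_all add: piv_defs)
  show ?thesis
    unfolding form_gradient_def sum_mons_pivots rest_grad_def l1 l2
    using k ij x by (simp add: of_bool_def if_distrib if_distribR sum.delta m[simplified] mon_eval_add mon_eval_single cong: if_cong)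
qed

lemma grad_split_j:
  assumes x: "x i = 1"
  shows "form_gradient n d h x j = rest_grad n d i j h x j + ((h (piv_edge d i j 1) + 2 * h (piv_edge d i j 2) * x j +
     3 * h (piv_edge d i j 3) * x j ^ 2) + (\<Sum>l\<in>{..<n} - {i, j}. h (piv_mixed d i j l) * x l))"
proof -
  let ?K = "{..<n} - {i, j}"
  have l1: "Poly_Mapping.lookup (piv_edge d i j r) j = r" for r
    using ij by (simp add: piv_defs lookup_add lookup_single)
  have l2: "Poly_Mapping.lookup (piv_vertex d i l) j = 0"
    "Poly_Mapping.lookup (piv_mixed d i j l) j = 1" if "l \<in> ?K" for l
    using ij that by (simp_all add: piv_defs lookup_add lookup_single when_def)
  have "piv_edge d i j r - Poly_Mapping.single j 1 = Poly_Mapping.single i (d - r) + Poly_Mapping.single j (r - 1)" for r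
    using ij by (intro poly_mapping_eqI) (auto simp: piv_defs lookup_add lookup_minus lookup_single when_def)
  then have m1: "mon_eval n x (piv_edge d i j r - Poly_Mapping.single j 1) = x j ^ (r - 1)" for r
    using ij x by (simp add: mon_eval_add mon_eval_single)
  have "piv_mixed d i j l - Poly_Mapping.single j 1 = Poly_Mapping.single i (d - 2) + Poly_Mapping.single l 1" for l
    using ij by (intro poly_mapping_eqI) (auto simp: piv_defs lookup_add lookup_minus lookup_single when_def)
  then have m2: "mon_eval n x (piv_mixed d i j l - Poly_Mapping.single j 1) = x l" if "l \<in> ?K" for l
    using ij x that by (simp add: mon_eval_add mon_eval_single)
  have "(\<Sum>r<4. of_nat r * h (piv_edge d i j r) * x j ^ (r - 1)) =
      h (piv_edge d i j 1) + 2 * h (piv_edge d i j 2) * x j + 3 * h (piv_edge d i j 3) * x j ^ 2"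
    by (simp add: eval_nat_numeral)
  then show ?thesis
    unfolding form_gradient_def sum_mons_pivots rest_grad_def l1 m1
    by (simp add: l2 m2[simplified] add.assoc)
qed

end

text \<open>
  A configuration \<open>(y, s, z, \<zeta>)\<close> consists of the coefficients \<open>y\<close> of a form, a position \<open>s\<close> on the
  line through it in the direction \<open>W\<close>, and two points.
\<close>

type_synonym config = "(nat monom \<Rightarrow> complex) \<times> complex \<times> (nat \<Rightarrow> complex) \<times> (nat \<Rightarrow> complex)"

definition shifted :: "(nat monom \<Rightarrow> complex) \<Rightarrow> config \<Rightarrow> nat monom \<Rightarrow> complex" where
  "shifted W = (\<lambda>(y, s, _, _) m. y m + s * W m)"

definition two_singular_points ::
    "nat \<Rightarrow> nat \<Rightarrow> (nat monom \<Rightarrow> complex) \<Rightarrow> nat \<Rightarrow> nat \<Rightarrow> config set" where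
  "two_singular_points n d W i j = {(y, s, z, \<zeta>). z i = 1 \<and> \<zeta> i = 1 \<and> z j \<noteq> \<zeta> j \<and>
     (\<forall>k<n. form_gradient n d (\<lambda>m. y m + s * W m) z k = 0 \<and> form_gradient n d (\<lambda>m. y m + s * W m) \<zeta> k = 0)}"

definition parameters :: "nat \<Rightarrow> nat \<Rightarrow> nat \<Rightarrow> nat \<Rightarrow> (config \<Rightarrow> complex) set" where
  "parameters n d i j =
     (\<lambda>m (y, s, z, \<zeta>). y m) ` (monoms n d - pivots n d i j) \<union>
     (\<lambda>k (y, s, z, \<zeta>). z k) ` ({..<n} - {i}) \<union>
     (\<lambda>k (y, s, z, \<zeta>). \<zeta> k) ` ({..<n} - {i}) \<union> {\<lambda>(y, s, z, \<zeta>). s}"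

lemma finite_parameters: "finite (parameters n d i j)"
  unfolding parameters_def using finite_monoms by simp

lemma card_parameters:
  assumes ij: "i < n" "j < n" "i \<noteq> j" and d: "d \<ge> 3"
  shows "card (parameters n d i j) < card (monoms n d)"
proof -
  let ?P = "monoms n d - pivots n d i j"
  have "card (A \<union> B \<union> C \<union> E) \<le> card A + card B + card C + card E" for A B C E :: "(config \<Rightarrow> complex) set"
    by (meson add_le_mono1 card_Un_le order_trans)
  from this[of "(\<lambda>m (y, s, z, \<zeta>). y m) ` ?P" "(\<lambda>k (y, s, z, \<zeta>). z k) ` ({..<n} - {i})"
     "(\<lambda>k (y, s, z, \<zeta>). \<zeta> k) ` ({..<n} - {i})" "{\<lambda>(y, s, z, \<zeta>). s}"]
  have "card (parameters n d i j) \<le> card ?P + (n - 1) + (n - 1) + 1"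
    unfolding parameters_def
    using card_image_le[of ?P "\<lambda>m (y :: nat monom \<Rightarrow> complex, s :: complex, z :: nat \<Rightarrow> complex, \<zeta> :: nat \<Rightarrow> complex). y m"]
      card_image_le[of "{..<n} - {i}" "\<lambda>k (y :: nat monom \<Rightarrow> complex, s :: complex, z :: nat \<Rightarrow> complex, \<zeta> :: nat \<Rightarrow> complex). z k"]
      card_image_le[of "{..<n} - {i}" "\<lambda>k (y :: nat monom \<Rightarrow> complex, s :: complex, z :: nat \<Rightarrow> complex, \<zeta> :: nat \<Rightarrow> complex). \<zeta> k"]
      finite_monoms ij by simp
  moreover have "card ?P + 2 * n = card (monoms n d)"
    using card_pivots[OF ij d] pivots_subset[OF ij d] finite_monoms[of n d]
    by (metis card_Diff_subset card_mono finite_subset le_add_diff_inverse2)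
  ultimately show ?thesis using ij by linarith
qed

lemma polynomial_denominator:
  assumes "i < n" "j < n" "i \<noteq> j"
  shows "polynomial_in (parameters n d i j) G 1 (\<lambda>(y, s, z, \<zeta>). \<zeta> j - z j)"
proof -
  let ?P = "parameters n d i j"
  define a b :: "config \<Rightarrow> complex" where "a = (\<lambda>(y, s, z, \<zeta>). \<zeta> j)" and "b = (\<lambda>(y, s, z, \<zeta>). z j)"
  have "a \<in> ?P" "b \<in> ?P" using assms unfolding parameters_def a_def b_def by blast+
  then have a: "polynomial_in ?P G 1 a" and b: "polynomial_in ?P G 1 b"
    by (simp_all only: polynomial_in_var[OF finite_parameters])
  have "polynomial_in ?P G (0 + 1) (\<lambda>t. -1 * b t)"
    by (intro polynomial_in_mult polynomial_in_const finite_parameters b)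
  then have "polynomial_in ?P G 1 (\<lambda>t. a t + -1 * b t)"
    using a by (intro polynomial_in_add) simp_all
  moreover have "(\<lambda>t. a t + -1 * b t) = (\<lambda>(y, s, z, \<zeta>). \<zeta> j - z j)"
    by (auto simp: a_def b_def)
  ultimately show ?thesis by simp
qed

text \<open>
  Hermite interpolation: values and derivatives at two points determine a cubic.
\<close>

lemma cubic_from_two_points:
  fixes w \<omega> :: "'a::field_char_0"
  assumes "h0 + h1 * w + h2 * w ^ 2 + h3 * w ^ 3 = A" and "h1 + 2 * h2 * w + 3 * h3 * w ^ 2 = A'"
    and "h0 + h1 * \<omega> + h2 * \<omega> ^ 2 + h3 * \<omega> ^ 3 = B" and "h1 + 2 * h2 * \<omega> + 3 * h3 * \<omega> ^ 2 = B'"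
    and "\<omega> - w \<noteq> 0"
  shows "h3 = ((A' + B') / (\<omega> - w) - 2 * ((B - A) / (\<omega> - w) / (\<omega> - w))) / (\<omega> - w)"
    and "h2 = ((B' - A') / (\<omega> - w) - 3 * h3 * (\<omega> + w)) / 2"
proof -
  have "(A' + B') * (\<omega> - w) - 2 * (B - A) = h3 * (\<omega> - w) ^ 3"
    unfolding assms(1-4) [symmetric] by algebra
  then have "h3 = ((A' + B') * (\<omega> - w) - 2 * (B - A)) / (\<omega> - w) ^ 3" using assms(5) by simp
  also have "\<dots> = ((A' + B') / (\<omega> - w) - 2 * ((B - A) / (\<omega> - w) / (\<omega> - w))) / (\<omega> - w)"
    using assms(5) by (simp add: diff_divide_distrib power3_eq_cube)
  finally show "h3 = ((A' + B') / (\<omega> - w) - 2 * ((B - A) / (\<omega> - w) / (\<omega> - w))) / (\<omega> - w)" .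
  have "B' - A' = (2 * h2 + 3 * h3 * (\<omega> + w)) * (\<omega> - w)"
    unfolding assms(1-4) [symmetric] by algebra
  then have "(B' - A') / (\<omega> - w) = 2 * h2 + 3 * h3 * (\<omega> + w)" using assms(5) by simp
  then show "h2 = ((B' - A') / (\<omega> - w) - 3 * h3 * (\<omega> + w)) / 2" by simp
qed

text \<open>
  The equations form a triangular system.  For each \<open>l\<close> other than \<open>i\<close> and \<open>j\<close>, the two
  derivatives with respect to \<open>x\<^sub>l\<close> give an affine function of \<open>x\<^sub>j\<close> at two points, hence the coefficients
  of \<open>x\<^sub>i^(d-2) x\<^sub>j x\<^sub>l\<close> and \<open>x\<^sub>i^(d-1) x\<^sub>l\<close>; with these known, the remaining four equations are a Hermite
  interpolation problem for the other four pivots.  The vanishing of the form itself replaces the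
  derivative with respect to \<open>x\<^sub>i\<close>, by Euler's identity.
\<close>

lemma coefficients_rational:
  assumes ij: "i < n" "j < n" "i \<noteq> j" and d: "d \<ge> 3" and m: "m \<in> monoms n d"
  shows "rational_fn (parameters n d i j) (\<lambda>(y, s, z, \<zeta>). \<zeta> j - z j) (two_singular_points n d W i j)
           (\<lambda>(y, s, z, \<zeta>). y m)"
proof -
  define P where "P = parameters n d i j"
  define D :: "config \<Rightarrow> complex" where "D = (\<lambda>(y, s, z, \<zeta>). \<zeta> j - z j)"
  define G where "G = two_singular_points n d W i j"
  define Y :: "nat monom \<Rightarrow> config \<Rightarrow> complex" where "Y = (\<lambda>m (y, s, z, \<zeta>). y m)"
  define Z :: "nat \<Rightarrow> config \<Rightarrow> complex" where "Z = (\<lambda>k (y, s, z, \<zeta>). z k)"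
  define Z' :: "nat \<Rightarrow> config \<Rightarrow> complex" where "Z' = (\<lambda>k (y, s, z, \<zeta>). \<zeta> k)"
  define S :: "config \<Rightarrow> complex" where "S = (\<lambda>(y, s, z, \<zeta>). s)"
  define H where "H = (\<lambda>m t. Y m t + S t * W m)"
  let ?K = "{..<n} - {i, j}"
  note defs = Y_def Z_def Z'_def S_def
  have P_eq: "P = Y ` (monoms n d - pivots n d i j) \<union> Z ` ({..<n} - {i}) \<union> Z' ` ({..<n} - {i}) \<union> {S}"
    by (simp add: P_def parameters_def defs)
  have finP: "finite P" by (simp add: P_def finite_parameters)
  have D_eq: "D = (\<lambda>t. Z' j t - Z j t)" by (auto simp: D_def defs)
  have Y_in: "Y m \<in> P" if "m \<in> monoms n d - pivots n d i j" for m
    using that unfolding P_eq by blast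
  have Z_in: "Z k \<in> P" if "k < n" "k \<noteq> i" for k using that unfolding P_eq by blast
  have Z'_in: "Z' k \<in> P" if "k < n" "k \<noteq> i" for k using that unfolding P_eq by blast
  have S_in: "S \<in> P" unfolding P_eq by blast
  have polyD: "polynomial_in P G 1 D"
    unfolding P_def D_def by (rule polynomial_denominator[OF ij])
  have good: "Z i t = 1" "Z' i t = 1" "D t \<noteq> 0"
    "k < n \<Longrightarrow> form_gradient n d (\<lambda>m. H m t) (\<lambda>k. Z k t) k = 0"
    "k < n \<Longrightarrow> form_gradient n d (\<lambda>m. H m t) (\<lambda>k. Z' k t) k = 0" if "t \<in> G" for t k
    using that by (auto simp: G_def two_singular_points_def D_def H_def defs)
  have val0: "form_value n d (\<lambda>m. H m t) (\<lambda>k. Z k t) = 0" "form_value n d (\<lambda>m. H m t) (\<lambda>k. Z' k t) = 0" if "t \<in> G" for t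
    using euler_identity[where n = n and d = d and x = "\<lambda>k. Z k t" and h = "\<lambda>m. H m t"]
      euler_identity[where n = n and d = d and x = "\<lambda>k. Z' k t" and h = "\<lambda>m. H m t"] good(4,5)[OF that] d
    by simp_all
  let ?R = "rational_fn P D G"
  note const = rational_fn_const[OF finP polyD good(3)]
    and var = rational_fn_var[OF finP polyD good(3)]
    and add = rational_fn_add[OF finP polyD good(3)]
    and diff = rational_fn_diff[OF finP polyD good(3)]
    and uminus = rational_fn_uminus[OF finP polyD good(3)]
    and mult = rational_fn_mult[OF finP polyD good(3)]
    and divide_D = rational_fn_divide_D[OF finP polyD good(3)]
    and power = rational_fn_power[OF finP polyD good(3)]
    and sum = rational_fn_sum[OF finP polyD good(3)]
    and prod = rational_fn_prod[OF finP polyD good(3)]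
  have Z: "?R (Z k)" if "k < n" for k
  proof (cases "k = i")
    case True
    then show ?thesis using good(1) by (intro rational_fn_cong[OF _ const[of 1]]) auto
  qed (use that in \<open>auto intro: var Z_in\<close>)
  have Z': "?R (Z' k)" if "k < n" for k
  proof (cases "k = i")
    case True
    then show ?thesis using good(2) by (intro rational_fn_cong[OF _ const[of 1]]) auto
  qed (use that in \<open>auto intro: var Z'_in\<close>)
  have S: "?R S" by (rule var[OF _ S_in])
  have H_free: "?R (H m)" if "m \<in> monoms n d - pivots n d i j" for m
    unfolding H_def using that by (intro add mult S const var Y_in)
  have eval: "?R (\<lambda>t. mon_eval n (\<lambda>k. Z k t) a)" "?R (\<lambda>t. mon_eval n (\<lambda>k. Z' k t) a)" for a
    unfolding mon_eval_def by (intro prod power Z Z'; simp)+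
  define g where "g = (\<lambda>k t. - rest_grad n d i j (\<lambda>m. H m t) (\<lambda>k. Z k t) k)"
  define g' where "g' = (\<lambda>k t. - rest_grad n d i j (\<lambda>m. H m t) (\<lambda>k. Z' k t) k)"
  define v where "v = (\<lambda>t. - rest_val n d i j (\<lambda>m. H m t) (\<lambda>k. Z k t))"
  define v' where "v' = (\<lambda>t. - rest_val n d i j (\<lambda>m. H m t) (\<lambda>k. Z' k t))"
  have g: "?R (g k)" "?R (g' k)" for k
    unfolding g_def g'_def rest_grad_def by (intro uminus sum mult const H_free eval; assumption)+
  have v: "?R v" "?R v'"
    unfolding v_def v'_def rest_val_def by (intro uminus sum mult H_free eval; assumption)+
  note split_other = grad_split_other[OF ij d] and split_j = grad_split_j[OF ij d] and split_val = val_split[OF ij d]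
  have other: "H (piv_vertex d i k) t + H (piv_mixed d i j k) t * Z j t = g k t"
    "H (piv_vertex d i k) t + H (piv_mixed d i j k) t * Z' j t = g' k t" if "t \<in> G" "k \<in> ?K" for t k
    using split_other[of "\<lambda>k. Z k t" k "\<lambda>m. H m t"] split_other[of "\<lambda>k. Z' k t" k "\<lambda>m. H m t"] good[OF that(1)] that(2)
    by (auto simp: g_def g'_def eq_neg_iff_add_eq_0 add.commute)
  have mixed: "?R (H (piv_mixed d i j k))" if "k \<in> ?K" for k
  proof (rule rational_fn_cong)
    fix t assume t: "t \<in> G"
    have "H (piv_mixed d i j k) t * D t = g' k t - g k t"
      unfolding other[OF t that, symmetric] D_eq by (simp add: algebra_simps)
    then show "H (piv_mixed d i j k) t = (g' k t - g k t) / D t"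
      using good(3)[OF t] by (simp add: field_simps)
  qed (intro divide_D diff g)
  have vertex: "?R (H (piv_vertex d i k))" if "k \<in> ?K" for k
  proof (rule rational_fn_cong)
    fix t assume t: "t \<in> G"
    show "H (piv_vertex d i k) t = g k t - H (piv_mixed d i j k) t * Z j t"
      using other(1)[OF t that] by (simp add: algebra_simps)
  qed (intro diff mult g mixed that Z ij)
  \<comment> \<open>The Hermite data of the cubic: values \<open>a0\<close>, \<open>b0\<close> and derivatives \<open>a1\<close>, \<open>b1\<close> at the two points.\<close>
  define a1 where "a1 = (\<lambda>t. g j t - (\<Sum>l\<in>?K. H (piv_mixed d i j l) t * Z l t))"
  define b1 where "b1 = (\<lambda>t. g' j t - (\<Sum>l\<in>?K. H (piv_mixed d i j l) t * Z' l t))"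
  define a0 where "a0 = (\<lambda>t. v t - (\<Sum>l\<in>?K. (H (piv_vertex d i l) t + H (piv_mixed d i j l) t * Z j t) * Z l t))"
  define b0 where "b0 = (\<lambda>t. v' t - (\<Sum>l\<in>?K. (H (piv_vertex d i l) t + H (piv_mixed d i j l) t * Z' j t) * Z' l t))"
  have ab: "?R a1" "?R b1" "?R a0" "?R b0"
    unfolding a1_def b1_def a0_def b0_def using ij
    by (intro diff sum mult add g v mixed vertex Z Z'; simp)+
  let ?h = "\<lambda>r t. H (piv_edge d i j r) t"
  have cubic: "?h 0 t + ?h 1 t * Z j t + ?h 2 t * Z j t ^ 2 + ?h 3 t * Z j t ^ 3 = a0 t"
    "?h 1 t + 2 * ?h 2 t * Z j t + 3 * ?h 3 t * Z j t ^ 2 = a1 t"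
    "?h 0 t + ?h 1 t * Z' j t + ?h 2 t * Z' j t ^ 2 + ?h 3 t * Z' j t ^ 3 = b0 t"
    "?h 1 t + 2 * ?h 2 t * Z' j t + 3 * ?h 3 t * Z' j t ^ 2 = b1 t" if t: "t \<in> G" for t
  proof -
    note sp = split_val[of "\<lambda>k. Z k t" "\<lambda>m. H m t"] split_val[of "\<lambda>k. Z' k t" "\<lambda>m. H m t"]
      split_j[of "\<lambda>k. Z k t" "\<lambda>m. H m t"] split_j[of "\<lambda>k. Z' k t" "\<lambda>m. H m t"]
    have edge: "(\<Sum>r<4. ?h r t * x ^ r) = ?h 0 t + ?h 1 t * x + ?h 2 t * x ^ 2 + ?h 3 t * x ^ 3" for x
      by (simp add: eval_nat_numeral)
    have solve: "e = - r - s" if "0 = r + (e + s)" for e r s :: complex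
      using that by algebra
    show "?h 0 t + ?h 1 t * Z j t + ?h 2 t * Z j t ^ 2 + ?h 3 t * Z j t ^ 3 = a0 t"
      using sp(1)[OF good(1)[OF t]] unfolding val0[OF t] a0_def v_def edge by (rule solve)
    show "?h 0 t + ?h 1 t * Z' j t + ?h 2 t * Z' j t ^ 2 + ?h 3 t * Z' j t ^ 3 = b0 t"
      using sp(2)[OF good(2)[OF t]] unfolding val0[OF t] b0_def v'_def edge by (rule solve)
    show "?h 1 t + 2 * ?h 2 t * Z j t + 3 * ?h 3 t * Z j t ^ 2 = a1 t"
      using sp(3)[OF good(1)[OF t]] unfolding good(4)[OF t ij(2)] a1_def g_def by (rule solve)
    show "?h 1 t + 2 * ?h 2 t * Z' j t + 3 * ?h 3 t * Z' j t ^ 2 = b1 t"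
      using sp(4)[OF good(2)[OF t]] unfolding good(5)[OF t ij(2)] b1_def g'_def by (rule solve)
  qed
  have D0: "Z' j t - Z j t \<noteq> 0" if "t \<in> G" for t using good(3)[OF that] by (simp add: D_eq)
  have h3: "?R (H (piv_edge d i j 3))"
  proof (rule rational_fn_cong)
    fix t assume t: "t \<in> G"
    show "?h 3 t = ((a1 t + b1 t) / D t - 2 * ((b0 t - a0 t) / D t / D t)) / D t"
      using cubic_from_two_points(1)[OF cubic[OF t] D0[OF t]] by (simp add: D_eq)
  qed (intro divide_D diff add mult const ab)
  have h2: "?R (H (piv_edge d i j 2))"
  proof (rule rational_fn_cong)
    fix t assume t: "t \<in> G"
    show "?h 2 t = ((b1 t - a1 t) / D t - 3 * ?h 3 t * (Z' j t + Z j t)) * (1 / 2)"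
      using cubic_from_two_points(2)[OF cubic[OF t] D0[OF t]] by (simp add: D_eq)
  qed (intro divide_D diff add mult const ab h3 Z Z' ij)
  have h1: "?R (H (piv_edge d i j 1))"
  proof (rule rational_fn_cong)
    fix t assume t: "t \<in> G"
    show "?h 1 t = a1 t - 2 * ?h 2 t * Z j t - 3 * ?h 3 t * Z j t ^ 2"
      using cubic(2)[OF t] by (simp add: algebra_simps)
  qed (intro diff mult power const ab h2 h3 Z ij)
  have h0: "?R (H (piv_edge d i j 0))"
  proof (rule rational_fn_cong)
    fix t assume t: "t \<in> G"
    show "?h 0 t = a0 t - ?h 1 t * Z j t - ?h 2 t * Z j t ^ 2 - ?h 3 t * Z j t ^ 3"
      using cubic(1)[OF t] by (simp add: algebra_simps)
  qed (intro diff mult power const ab h1 h2 h3 Z ij)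
  have "?R (H m)"
  proof (cases "m \<in> pivots n d i j")
    case False
    then show ?thesis using m by (intro H_free) auto
  next
    case True
    moreover have "?R (H (piv_edge d i j r))" if "r < 4" for r
    proof -
      from that have "r = 0 \<or> r = 1 \<or> r = 2 \<or> r = 3" by auto
      then show ?thesis using h0 h1 h2 h3 by auto
    qed
    ultimately show ?thesis using vertex mixed by (auto simp: pivots_def)
  qed
  then have "?R (\<lambda>t. H m t - S t * W m)" by (intro diff mult S const)
  then have "?R (Y m)" by (simp add: H_def)
  then show ?thesis by (simp add: Y_def P_def D_def G_def)
qed

section \<open>Segments that avoid singular forms\<close>

text \<open>
  The exceptional \<open>y\<close> are covered by one rationally parametrized family for each pair \<open>(i, j)\<close>.
  These finitely many charts suffice for the application: a point that is not a multiple of a real one,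
  scaled to have \<open>i\<close>-th coordinate \<open>1\<close>, differs from its conjugate in some \<open>j\<close>-th coordinate.
\<close>

lemma generic_avoidance:
  fixes W y0 :: "nat monom \<Rightarrow> real"
  assumes d: "d \<ge> 3" and \<epsilon>: "\<epsilon> > 0"
  obtains y where "\<And>m. m \<in> monoms n d \<Longrightarrow> \<bar>y m - y0 m\<bar> < \<epsilon>"
    and "\<And>i j s z \<zeta>. \<lbrakk>i < n; j < n; i \<noteq> j\<rbrakk> \<Longrightarrow>
           (\<lambda>m. complex_of_real (y m), s, z, \<zeta>) \<notin> two_singular_points n d (\<lambda>m. complex_of_real (W m)) i j"
proof -
  let ?W = "\<lambda>m. complex_of_real (W m)"
  define C where "C = {(i, j). i < n \<and> j < n \<and> i \<noteq> j}"
  define V where "V = (\<lambda>(i, j). parameters n d i j)"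
  define G where "G = (\<lambda>(i, j). two_singular_points n d ?W i j)"
  define D where "D = (\<lambda>(i :: nat, j :: nat) (y :: nat monom \<Rightarrow> complex, s :: complex, z :: nat \<Rightarrow> complex, \<zeta> :: nat \<Rightarrow> complex). \<zeta> j - z j)"
  define \<phi> where "\<phi> = (\<lambda>(c :: nat \<times> nat) m (y :: nat monom \<Rightarrow> complex, s :: complex, z :: nat \<Rightarrow> complex, \<zeta> :: nat \<Rightarrow> complex). y m)"
  have "C \<subseteq> {..<n} \<times> {..<n}" by (auto simp: C_def)
  then have finC: "finite C" by (rule finite_subset) simp
  obtain L q where q: "\<exists>\<alpha>\<in>monoms n d \<rightarrow>\<^sub>E {..<L}. q \<alpha> \<noteq> 0"
    and zero: "\<And>c t. c \<in> C \<Longrightarrow> t \<in> G c \<Longrightarrow>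
           (\<Sum>\<alpha>\<in>monoms n d \<rightarrow>\<^sub>E {..<L}. q \<alpha> * (\<Prod>m\<in>monoms n d. \<phi> c m t ^ \<alpha> m)) = 0"
  proof (rule dimension_bound[of "monoms n d" C V G D \<phi>])
    fix c assume c: "c \<in> C"
    then obtain i j where ij: "c = (i, j)" "i < n" "j < n" "i \<noteq> j" by (auto simp: C_def)
    show "finite (V c)" by (simp add: V_def ij finite_parameters)
    show "card (V c) < card (monoms n d)" unfolding V_def ij(1) using card_parameters[OF ij(2-4) d] by simp
    show "polynomial_in (V c) (G c) 1 (D c)"
      unfolding V_def D_def ij(1) using polynomial_denominator[OF ij(2-4)] by simp
    show "D c t \<noteq> 0" if "t \<in> G c" for t
      using that by (auto simp: D_def G_def ij two_singular_points_def)
    show "\<exists>e. rational_in (V c) (D c) (G c) e (\<phi> c m)" if "m \<in> monoms n d" for m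
      using coefficients_rational[OF ij(2-4) d that, of ?W]
      by (simp add: rational_fn_def V_def D_def G_def \<phi>_def ij(1))
  qed (use finite_monoms finC in auto)
  obtain y where y: "\<forall>m\<in>monoms n d. \<bar>y m - y0 m\<bar> < \<epsilon>"
    and nz: "(\<Sum>\<alpha>\<in>monoms n d \<rightarrow>\<^sub>E {..<L}. q \<alpha> * (\<Prod>m\<in>monoms n d. complex_of_real (y m) ^ \<alpha> m)) \<noteq> 0"
    using polynomial_nonzero_nearby[OF finite_monoms q \<epsilon>, of y0] by blast
  show ?thesis
  proof (rule that[of y])
    fix i j s z \<zeta> assume ij: "i < n" "j < n" "i \<noteq> j"
    then have "(i, j) \<in> C" by (simp add: C_def)
    from zero[OF this, of "(\<lambda>m. complex_of_real (y m), s, z, \<zeta>)"] nz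
    show "(\<lambda>m. complex_of_real (y m), s, z, \<zeta>) \<notin> two_singular_points n d ?W i j"
      by (auto simp: G_def \<phi>_def)
  qed (use y in auto)
qed

text \<open>
  After scaling one coordinate of \<open>z\<close> to \<open>1\<close>, some other coordinate is not real, because Euler's
  identity rules out real singular points.  So the conjugate of the scaled point is
  a second singular point.  In degree \<open>2\<close> already the real part is singular, whence \<open>d \<ge> 3\<close>.
\<close>

lemma posdef_singular_point:
  fixes h :: "nat monom \<Rightarrow> real"
  assumes pos: "\<And>x. \<exists>i<n. x i \<noteq> 0 \<Longrightarrow> form_value n d h x > 0" and d: "d \<ge> 2"
    and z: "\<exists>i<n. z i \<noteq> 0" "\<And>k. k < n \<Longrightarrow> form_gradient n d (\<lambda>m. complex_of_real (h m)) z k = 0"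
  obtains i j z' \<zeta> where "i < n" "j < n" "i \<noteq> j" "d \<ge> 3" "z' i = 1" "\<zeta> i = 1" "z' j \<noteq> \<zeta> j"
    "\<And>k. k < n \<Longrightarrow> form_gradient n d (\<lambda>m. complex_of_real (h m)) z' k = 0"
    "\<And>k. k < n \<Longrightarrow> form_gradient n d (\<lambda>m. complex_of_real (h m)) \<zeta> k = 0"
proof -
  let ?h = "\<lambda>m. complex_of_real (h m)"
  have real: False if "\<exists>i<n. x i \<noteq> 0" "\<And>k. k < n \<Longrightarrow> form_gradient n d h x k = 0" for x
    using euler_identity[where n = n and d = d and x = x and h = h] pos[OF that(1)] that(2) d by simp
  obtain i where i: "i < n" "z i \<noteq> 0" using z by blast
  define z' where "z' = (\<lambda>k. 1 / z i * z k)"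
  have z'i: "z' i = 1" using i by (simp add: z'_def)
  have gz': "form_gradient n d ?h z' k = 0" if "k < n" for k
    unfolding z'_def grad_scale using z(2)[OF that] by simp
  have "\<exists>j<n. Im (z' j) \<noteq> 0"
  proof (rule ccontr)
    assume "\<not> ?thesis"
    then have eq: "complex_of_real (Re (z' k)) = z' k" if "k < n" for k
      using that by (simp add: complex_eq_iff)
    have "mon_eval n (\<lambda>k. complex_of_real (Re (z' k))) m = mon_eval n z' m" for m
      using eq by (intro mon_eval_cong)
    then have "complex_of_real (form_gradient n d h (\<lambda>k. Re (z' k)) k) = form_gradient n d ?h z' k" for k
      unfolding grad_of_real [symmetric] by (simp add: form_gradient_def)
    then have "form_gradient n d h (\<lambda>k. Re (z' k)) k = 0" if "k < n" for k
      using gz'[OF that] by (metis of_real_eq_0_iff)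
    then show False using real[of "\<lambda>k. Re (z' k)"] i(1) z'i by (metis one_complex.sel(1) zero_neq_one)
  qed
  then obtain j where j: "j < n" "Im (z' j) \<noteq> 0" by blast
  have "d \<noteq> 2"
  proof
    assume "d = 2"
    then have "form_gradient n d h (\<lambda>k. Re (z' k)) k = 0" if "k < n" for k
      using gz'[OF that] by (simp add: grad_Re)
    then show False using real[of "\<lambda>k. Re (z' k)"] i(1) z'i by (metis one_complex.sel(1) zero_neq_one)
  qed
  show ?thesis
  proof (rule that[of i j z' "\<lambda>k. cnj (z' k)"])
    show "z' j \<noteq> cnj (z' j)" using j by (auto simp: complex_eq_iff)
    show "i \<noteq> j" using j z'i by auto
    show "form_gradient n d ?h (\<lambda>k. cnj (z' k)) k = 0" if "k < n" for k
      using gz'[OF that] by (simp add: grad_cnj)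
  qed (use i j d \<open>d \<noteq> 2\<close> z'i gz' in auto)
qed

section \<open>The sign of the discriminant on positive definite forms\<close>

lemma abs_mon_eval_le:
  fixes x :: "nat \<Rightarrow> real"
  assumes "m \<in> monoms n d" and "even d" and "n \<ge> 1"
  shows "\<bar>mon_eval n x m\<bar> \<le> (\<Sum>j<n. x j ^ d)"
proof -
  define b where "b = Max ((\<lambda>j. \<bar>x j\<bar>) ` {..<n})"
  have "b \<in> (\<lambda>j. \<bar>x j\<bar>) ` {..<n}" unfolding b_def using assms(3) by (intro Max_in) (auto simp: lessThan_empty_iff)
  then obtain k where k: "k < n" "b = \<bar>x k\<bar>" by auto
  have le: "\<bar>x j\<bar> \<le> b" if "j < n" for j unfolding b_def using that by (intro Max_ge) auto
  have "\<bar>mon_eval n x m\<bar> = (\<Prod>j<n. \<bar>x j\<bar> ^ Poly_Mapping.lookup m j)"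
    by (simp add: mon_eval_def abs_prod power_abs)
  also have "\<dots> \<le> (\<Prod>j<n. b ^ Poly_Mapping.lookup m j)"
    using le by (intro prod_mono) (auto intro: power_mono)
  also have "\<dots> = b ^ d" using assms(1) by (auto simp: power_sum monoms_def monom_degree_eq)
  also have "\<dots> = x k ^ d" using k assms(2) by (simp add: power_even_abs)
  also have "\<dots> \<le> (\<Sum>j<n. x j ^ d)"
    using k assms(2) by (intro member_le_sum) (auto simp: zero_le_even_power)
  finally show ?thesis .
qed

lemma fermat_form_in_forms: "fermat_form n d \<in> forms n d"
proof -
  have "Poly_Mapping.keys (fermat_form n d) \<subseteq> (\<Union>j<n. {Poly_Mapping.single j d})"
    unfolding fermat_form_def by (rule order_trans[OF keys_sum]) (auto split: if_splits)
  moreover have "Poly_Mapping.single j d \<in> monoms n d" if "j < n" for j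
  proof -
    have "Poly_Mapping.keys (Poly_Mapping.single j d) \<subseteq> {..<n}" using that by auto
    moreover from this have "monom_degree (Poly_Mapping.single j d) = d"
      using that by (simp add: monom_degree_eq lookup_single when_def)
    ultimately show ?thesis by (simp add: monoms_def)
  qed
  ultimately show ?thesis by (auto simp: forms_iff)
qed

lemma val_fermat_form: "form_value n d (Poly_Mapping.lookup (fermat_form n d)) x = (\<Sum>j<n. x j ^ d)"
proof -
  have "form_value n d (Poly_Mapping.lookup (fermat_form n d)) x = eval_form (fermat_form n d) x"
    by (rule eval_form_eq_val[OF fermat_form_in_forms, symmetric])
  also have "\<dots> = (\<Sum>j<n. x j ^ d)"
    unfolding fermat_form_def eval_form_sum
  proof (intro sum.cong refl)
    fix j assume j: "j \<in> {..<n}"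
    then have "Poly_Mapping.keys (Poly_Mapping.single j d) \<subseteq> {..<n}" by auto
    from eval_form_single[OF this, where c = 1 and x = x] show "eval_form (Poly_Mapping.single (Poly_Mapping.single j d) 1) x = x j ^ d"
      using j by (simp add: mon_eval_single)
  qed
  finally show ?thesis .
qed

lemma of_real_of_rat: "complex_of_real (of_rat q) = of_rat q"
  by (cases q) (simp add: of_rat_rat)

lemma singular_of_discriminant_zero:
  fixes h :: "nat monom \<Rightarrow> real"
  assumes \<Delta>: "is_discriminant n d \<Delta>" and zero: "eval_mpoly of_rat h \<Delta> = 0"
  obtains z where "\<exists>i<n. z i \<noteq> 0"
    and "\<And>k. k < n \<Longrightarrow> form_gradient n d (\<lambda>m. complex_of_real (h m)) z k = 0"
proof -
  define F where "F = Poly_Mapping.Abs_poly_mapping (\<lambda>m. if m \<in> monoms n d then complex_of_real (h m) else 0)"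
  have F: "Poly_Mapping.lookup F m = (if m \<in> monoms n d then complex_of_real (h m) else 0)" for m
  proof -
    have "finite {m. (if m \<in> monoms n d then complex_of_real (h m) else 0) \<noteq> 0}"
      by (rule finite_subset[OF _ finite_monoms[of n d]]) auto
    then show ?thesis unfolding F_def by (subst lookup_Abs_poly_mapping) auto
  qed
  have form: "F \<in> forms n d" by (auto simp: forms_iff in_keys_iff F split: if_splits)
  have "vars \<Delta> \<subseteq> monoms n d" using \<Delta> by (simp add: is_discriminant_def monoms_def)
  then have F_h: "Poly_Mapping.lookup F v = complex_of_real (h v)" if "a \<in> Poly_Mapping.keys \<Delta>" "v \<in> Poly_Mapping.keys a" for a v
    using that by (auto simp: F vars_def)
  have "eval_mpoly of_rat (Poly_Mapping.lookup F) \<Delta> = complex_of_real (eval_mpoly of_rat h \<Delta>)"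
    unfolding eval_mpoly_def of_real_sum
  proof (intro sum.cong refl)
    fix a assume a: "a \<in> Poly_Mapping.keys \<Delta>"
    have "(\<Prod>v\<in>Poly_Mapping.keys a. Poly_Mapping.lookup F v ^ Poly_Mapping.lookup a v)
        = (\<Prod>v\<in>Poly_Mapping.keys a. complex_of_real (h v) ^ Poly_Mapping.lookup a v)"
      using F_h[OF a] by (intro prod.cong) auto
    then show "of_rat (Poly_Mapping.lookup \<Delta> a) * (\<Prod>v\<in>Poly_Mapping.keys a. Poly_Mapping.lookup F v ^ Poly_Mapping.lookup a v)
        = complex_of_real (of_rat (Poly_Mapping.lookup \<Delta> a) * (\<Prod>v\<in>Poly_Mapping.keys a. h v ^ Poly_Mapping.lookup a v))"
      by (simp add: of_real_of_rat)
  qed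
  also have "\<dots> = 0" using zero by simp
  finally have "F \<in> singular_forms n d" using \<Delta> form by (auto simp: is_discriminant_def)
  then obtain z where z: "\<exists>i<n. z i \<noteq> 0" "\<And>k. k < n \<Longrightarrow> form_gradient n d (Poly_Mapping.lookup F) z k = 0"
    unfolding singular_forms_def using eval_partial_deriv_eq_grad[OF form] by auto
  moreover have "form_gradient n d (Poly_Mapping.lookup F) z k = form_gradient n d (\<lambda>m. complex_of_real (h m)) z k" for k
    by (simp add: form_gradient_def F)
  ultimately show ?thesis using that by auto
qed

lemma tendsto_eval_mpoly:
  fixes h :: "'v \<Rightarrow> real"
  assumes "\<And>v. v \<in> vars p \<Longrightarrow> ((\<lambda>x. g x v) \<longlongrightarrow> h v) A"
  shows "((\<lambda>x. eval_mpoly of_rat (g x) p) \<longlongrightarrow> eval_mpoly of_rat h p) A"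
  unfolding eval_mpoly_def using assms
  by (intro tendsto_sum tendsto_mult tendsto_const tendsto_prod tendsto_power) (auto simp: vars_def)

lemma lookup_fermat_form_of_rat:
  "Poly_Mapping.lookup (fermat_form n d) = (\<lambda>m. real_of_rat (Poly_Mapping.lookup (fermat_form n d) m))"
  by (rule ext) (auto simp: fermat_form_def lookup_sum lookup_single when_def of_rat_sum intro!: sum.cong)

lemma eval_mpoly_of_rat:
  "eval_mpoly of_rat (\<lambda>v. real_of_rat (x v)) p = real_of_rat (eval_mpoly (\<lambda>c. c) x p)"
  by (simp add: eval_mpoly_def of_rat_sum of_rat_mult of_rat_prod of_rat_power)

text \<open>
  The hypothesis \<open>c \<Sum>\<^sub>j x\<^sub>j\<^sup>d \<le> G(x)\<close> is positive definiteness with an explicit constant: on the segment from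
  \<open>J\<close> to \<open>G\<close> the values are at least \<open>min 1 c * J(x)\<close>, which absorbs a perturbation of each coefficient
  by less than \<open>min 1 c / N\<close>, since \<open>J\<close> dominates every monomial.
\<close>

lemma discriminant_nonneg_posdef:
  assumes n: "n \<ge> 1" and d: "d \<ge> 2" "even d" and \<Delta>: "is_discriminant n d \<Delta>"
    and c: "c > 0" and g: "\<And>x. form_value n d g x \<ge> c * (\<Sum>j<n. x j ^ d)"
  shows "eval_mpoly of_rat g \<Delta> \<ge> (0 :: real)"
proof (rule ccontr)
  assume "\<not> ?thesis"
  then have neg: "eval_mpoly of_rat g \<Delta> < 0" by simp
  define J :: "nat monom \<Rightarrow> real" where "J = Poly_Mapping.lookup (fermat_form n d)"
  define W where "W = (\<lambda>m. g m - J m)"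
  have vars: "vars \<Delta> \<subseteq> monoms n d" using \<Delta> by (simp add: is_discriminant_def monoms_def)
  have "eval_mpoly (\<lambda>c. c) (Poly_Mapping.lookup (fermat_form n d)) \<Delta> = 1"
    using \<Delta> by (simp add: is_discriminant_def)
  then have J1: "eval_mpoly of_rat J \<Delta> = 1"
    unfolding J_def lookup_fermat_form_of_rat eval_mpoly_of_rat by simp
  define near where "near = (\<lambda>k y. (\<forall>m\<in>monoms n d. \<bar>y m - J m\<bar> < 1 / real (Suc k)) \<and>
      (d \<ge> 3 \<longrightarrow> (\<forall>i j s z \<zeta>. i < n \<longrightarrow> j < n \<longrightarrow> i \<noteq> j \<longrightarrow>
         (\<lambda>m. complex_of_real (y m), s, z, \<zeta>) \<notin> two_singular_points n d (\<lambda>m. complex_of_real (W m)) i j)))"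
  have "\<exists>y. near k y" for k
  proof (cases "d \<ge> 3")
    case True
    have "0 < 1 / real (Suc k)" by simp
    then obtain y where "\<And>m. m \<in> monoms n d \<Longrightarrow> \<bar>y m - J m\<bar> < 1 / real (Suc k)"
      "\<And>i j s z \<zeta>. \<lbrakk>i < n; j < n; i \<noteq> j\<rbrakk> \<Longrightarrow>
         (\<lambda>m. complex_of_real (y m), s, z, \<zeta>) \<notin> two_singular_points n d (\<lambda>m. complex_of_real (W m)) i j"
      using generic_avoidance[OF True, of "1 / real (Suc k)" n J W] by blast
    then show ?thesis by (intro exI[of _ y]) (auto simp: near_def)
  next
    case False
    then show ?thesis by (intro exI[of _ J]) (auto simp: near_def)
  qed
  then obtain Y where "\<And>k. near k (Y k)" by metis
  then have Y: "\<And>k m. m \<in> monoms n d \<Longrightarrow> \<bar>Y k m - J m\<bar> < 1 / real (Suc k)"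
    and avoid: "\<And>k i j s z \<zeta>. \<lbrakk>d \<ge> 3; i < n; j < n; i \<noteq> j\<rbrakk> \<Longrightarrow>
         (\<lambda>m. complex_of_real (Y k m), s, z, \<zeta>) \<notin> two_singular_points n d (\<lambda>m. complex_of_real (W m)) i j"
    unfolding near_def by blast+
  \<comment> \<open>The signs at both ends and positive definiteness in between persist for \<open>Y k\<close> close to \<open>J\<close>.\<close>
  have lim: "(\<lambda>k. Y k m) \<longlonglongrightarrow> J m" if "m \<in> monoms n d" for m
  proof -
    have "(\<lambda>k. Y k m - J m) \<longlonglongrightarrow> 0"
      using Y[OF that]
      by (intro tendsto_0_le[OF LIMSEQ_Suc[OF lim_inverse_n'], where K = 1])
         (auto intro!: always_eventually simp: less_imp_le simp del: of_nat_Suc)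
    then show ?thesis by (rule LIM_zero_cancel)
  qed
  have "(\<lambda>k. eval_mpoly of_rat (Y k) \<Delta>) \<longlonglongrightarrow> eval_mpoly of_rat J \<Delta>"
    using lim vars by (intro tendsto_eval_mpoly) auto
  then have ev1: "\<forall>\<^sub>F k in sequentially. eval_mpoly of_rat (Y k) \<Delta> > (0::real)"
    unfolding J1 by (rule order_tendstoD) simp
  have "(\<lambda>k. Y k m + W m) \<longlonglongrightarrow> g m" if "m \<in> monoms n d" for m
    using tendsto_add[OF lim[OF that] tendsto_const[of "W m"]] by (simp add: W_def)
  then have "(\<lambda>k. eval_mpoly of_rat (\<lambda>m. Y k m + W m) \<Delta>) \<longlonglongrightarrow> eval_mpoly of_rat g \<Delta>"
    using vars by (intro tendsto_eval_mpoly) auto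
  then have ev2: "\<forall>\<^sub>F k in sequentially. eval_mpoly of_rat (\<lambda>m. Y k m + W m) \<Delta> < (0::real)"
    by (rule order_tendstoD) (rule neg)
  define b where "b = min 1 c"
  have b: "b > 0" using c by (simp add: b_def)
  define N where "N = real (card (monoms n d))"
  have "(\<lambda>k. 1 / real (Suc k) * N) \<longlonglongrightarrow> 0 * N"
    by (intro tendsto_mult tendsto_const LIMSEQ_Suc[OF lim_inverse_n'])
  then have ev3: "\<forall>\<^sub>F k in sequentially. 1 / real (Suc k) * N < b"
    by (rule order_tendstoD) (simp add: b)
  obtain k where k: "eval_mpoly of_rat (Y k) \<Delta> > (0::real)"
    "eval_mpoly of_rat (\<lambda>m. Y k m + W m) \<Delta> < (0::real)" "1 / real (Suc k) * N < b"
    using eventually_happens[OF eventually_conj[OF ev1 eventually_conj[OF ev2 ev3]]] by auto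
  \<comment> \<open>The segment from \<open>Y k\<close> to \<open>Y k + W\<close> crosses the zero set of the discriminant.\<close>
  define H where "H = (\<lambda>s m. Y k m + s * W m)"
  have "continuous_on {0..1} (\<lambda>s. eval_mpoly of_rat (H s) \<Delta>)"
    unfolding eval_mpoly_def H_def by (intro continuous_intros)
  moreover have "eval_mpoly of_rat (H 1) \<Delta> \<le> 0" "0 \<le> eval_mpoly of_rat (H 0) \<Delta>"
    using k(1,2) by (simp_all add: H_def)
  ultimately obtain s where s: "0 \<le> s" "s \<le> 1" "eval_mpoly of_rat (H s) \<Delta> = 0"
    using IVT2'[of "\<lambda>s. eval_mpoly of_rat (H s) \<Delta>" 1 0 0] by auto
  obtain z where z: "\<exists>i<n. z i \<noteq> 0" "\<And>k. k < n \<Longrightarrow> form_gradient n d (\<lambda>m. complex_of_real (H s m)) z k = 0"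
    using singular_of_discriminant_zero[OF \<Delta> s(3)] by blast
  have pos: "form_value n d (H s) x > 0" if x: "\<exists>i<n. x i \<noteq> 0" for x
  proof -
    define q where "q = (\<Sum>j<n. x j ^ d)"
    have "q > 0"
    proof -
      obtain i where i: "i < n" "x i \<noteq> 0" using x by blast
      then have "0 < x i ^ d" using d by (simp add: zero_less_power_eq)
      also have "\<dots> \<le> q" unfolding q_def
        using i d by (intro member_le_sum) (auto simp: zero_le_even_power)
      finally show ?thesis .
    qed
    have "form_value n d J x = q" by (simp add: J_def val_fermat_form q_def)
    moreover have "form_value n d (H s) x = (1 - s) * form_value n d J x + s * form_value n d g x + form_value n d (\<lambda>m. Y k m - J m) x"
      by (simp add: form_value_def H_def W_def sum_distrib_left sum.distrib [symmetric] algebra_simps)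
    ultimately have "form_value n d (H s) x = (1 - s) * q + s * form_value n d g x + form_value n d (\<lambda>m. Y k m - J m) x" by simp
    moreover have "s * form_value n d g x \<ge> s * (c * q)"
      using g[of x] s by (intro mult_left_mono) (auto simp: q_def)
    moreover have "\<bar>form_value n d (\<lambda>m. Y k m - J m) x\<bar> \<le> 1 / real (Suc k) * N * q"
    proof -
      have "\<bar>form_value n d (\<lambda>m. Y k m - J m) x\<bar> \<le> (\<Sum>m\<in>monoms n d. \<bar>(Y k m - J m) * mon_eval n x m\<bar>)"
        unfolding form_value_def by (rule sum_abs)
      also have "\<dots> \<le> (\<Sum>m\<in>monoms n d. 1 / real (Suc k) * q)"
        unfolding abs_mult q_def using Y abs_mon_eval_le d n
        by (intro sum_mono mult_mono) (auto intro: less_imp_le)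
      finally show ?thesis by (simp add: N_def ac_simps)
    qed
    moreover have "1 / real (Suc k) * N * q < b * q" using k(3) \<open>q > 0\<close> by (rule mult_strict_right_mono)
    moreover have "b * q \<le> (1 - s) * q + s * (c * q)"
    proof -
      have "b = (1 - s) * b + s * b" by (simp add: algebra_simps)
      also have "\<dots> \<le> (1 - s) * 1 + s * c"
        using s by (intro add_mono mult_left_mono) (auto simp: b_def)
      finally have "b * q \<le> ((1 - s) * 1 + s * c) * q" using \<open>q > 0\<close> by (intro mult_right_mono) auto
      then show ?thesis by (simp add: algebra_simps)
    qed
    ultimately show ?thesis by linarith
  qed
  obtain i j z' \<zeta> where ij: "i < n" "j < n" "i \<noteq> j" "d \<ge> 3" "z' i = 1" "\<zeta> i = 1" "z' j \<noteq> \<zeta> j"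
    "\<And>k. k < n \<Longrightarrow> form_gradient n d (\<lambda>m. complex_of_real (H s m)) z' k = 0"
    "\<And>k. k < n \<Longrightarrow> form_gradient n d (\<lambda>m. complex_of_real (H s m)) \<zeta> k = 0"
    using posdef_singular_point[OF pos d(1) z] by blast
  then have "(\<lambda>m. complex_of_real (Y k m), complex_of_real s, z', \<zeta>)
      \<in> two_singular_points n d (\<lambda>m. complex_of_real (W m)) i j"
    by (simp add: two_singular_points_def H_def)
  with avoid[OF ij(4,1,2,3)] show False by blast
qed

theorem mainTheorem1:
  fixes n d :: nat
    and \<Delta> :: "(nat monom, rat) mpoly"
    and F :: "(nat, real) mpoly"
  assumes "n \<ge> 1" and "d \<ge> 2" and "even d"
    and "is_discriminant n d \<Delta>"
    and "F \<in> forms n d"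
    and "nonneg_form F"
  shows "\<forall>t\<ge>0. poly (char_poly_form n d \<Delta> F) t \<ge> 0"
proof (intro allI impI)
  fix t :: real assume t: "t \<ge> 0"
  let ?\<chi> = "char_poly_form n d \<Delta> F"
  have pos: "poly ?\<chi> u \<ge> 0" if u: "u > 0" for u
    unfolding poly_char_poly_form
  proof (rule discriminant_nonneg_posdef[OF assms(1-4) u])
    fix x
    have "form_value n d (Poly_Mapping.lookup (F + const_mpoly u * fermat_form n d)) x
        = form_value n d (Poly_Mapping.lookup F) x + u * form_value n d (Poly_Mapping.lookup (fermat_form n d)) x"
      by (simp add: form_value_def lookup_add lookup_const_mult sum_distrib_left sum.distrib [symmetric] algebra_simps)
    moreover have "form_value n d (Poly_Mapping.lookup F) x \<ge> 0"
      using assms(6) unfolding eval_form_eq_val[OF assms(5), symmetric] nonneg_form_def by blast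
    ultimately show "u * (\<Sum>j<n. x j ^ d) \<le> form_value n d (Poly_Mapping.lookup (F + const_mpoly u * fermat_form n d)) x"
      by (simp add: val_fermat_form)
  qed
  have "(\<lambda>k. t + 1 / real (Suc k)) \<longlonglongrightarrow> t + 0"
    by (intro tendsto_add tendsto_const LIMSEQ_Suc[OF lim_inverse_n'])
  then have "(\<lambda>k. poly ?\<chi> (t + 1 / real (Suc k))) \<longlonglongrightarrow> poly ?\<chi> t"
    by (intro tendsto_poly) simp
  then show "poly ?\<chi> t \<ge> 0"
    by (rule LIMSEQ_le_const) (use t in \<open>auto intro!: exI[of _ 0] pos add_nonneg_pos\<close>)
qed

end
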